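(* Let $F$ be a one-dimensional tropical fan in $\mathbb{R}^n$ whose rays span $\mathbb{R}^n$. 1. $F$ is regular if and only if there is a $\mathbb{Z}$-linear map $\pi_F:\mathbb{R}^n\to\mathbb{R}^d$ such that $(\pi_F)_*(F)$ is a direct sum of finitely many (at least one) one-dimensional Bergman fans, and such that every $\mathbb{Z}$-linear map $\pi:\mathbb{R}^n\to\mathbb{R}^r$ for which $\pi_*(F)$ is also a direct sum of one-dimensional Bergman fans factors through $\pi_F$, i.e. $\pi=\psi\circ\pi_F$ for some $\mathbb{Z}$-linear map $\psi:\mathbb{R}^d\to\mathbb{R}^r$. 2. If $F$ is regular and $\pi_F:\mathbb{R}^n\to\mathbb{R}^d$ is as in 1 (so $d=\dim\langle(\pi_F)_*(F)\rangle$), then every regular sequence on $F$ lifts from a regular sequence on $(\pi_F)_*(F)$: for every non-negative TR function $M:\mathbb{R}^n\to\mathbb{R}$ with $M\cdot F=1$ there is a non-negative TR function $M':\mathbb{R}^d\to\mathbb{R}$ with $M'\cdot(\pi_F)_*(F)=1$ and $M=M'\circ\pi_F$.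
   Context: A one-dimensional tropical fan $F$ in $\mathbb{R}^n$ consists of finitely many distinct rays $\mathbb{R}_+v_1,\dots,\mathbb{R}_+v_q$ (and the origin), with $v_i\in\mathbb{Z}^n$ primitive, together with positive integer weights $\omega_1,\dots,\omega_q$ satisfying the balancing condition $\sum_i\omega_iv_i=0$. $\langle F\rangle$ is the linear span of the rays of $F$. A tropical regular (TR) function on $\mathbb{R}^n$ is a function $x\mapsto\max(l_1(x),\dots,l_k(x))$ with $l_i\in(\mathbb{Z}^n)^\vee$ integer linear forms; a non-negative TR function is one of the form $\max(0,l_1,\dots,l_k)$. For a TR function $M$, the intersection number is $M\cdot F=\sum_{i=1}^q\omega_iM(v_i)$. $F$ is regular if there is a non-negative TR function $M$ with $M\cdot F=1$; such an $M$ is called a regular sequence on $F$. A $\mathbb{Z}$-linear map $\mathbb{R}^n\to\mathbb{R}^r$ is a linear map sending $\mathbb{Z}^n$ to $\mathbb{Z}^r$. The push-forward $\pi_*(F)$ under a $\mathbb{Z}$-linear map $\pi$ has as rays the half-lines spanned by the nonzero $\pi(v_i)$; the weight of the ray with primitive generator $u$ is $\sum\omega_im_i$, the sum over all $i$ with $\pi(v_i)=m_iu$, $m_i>0$. A one-dimensional Bergman fan in a lattice $N$ of rank $k\ge1$ is the tropical fan in $N\otimes\mathbb{R}$ with rays generated by $u_0,u_1,\dots,u_k$, all of weight $1$, where $u_1,\dots,u_k$ is a $\mathbb{Z}$-basis of $N$ and $u_0=-(u_1+\dots+u_k)$. A tropical fan in $\mathbb{R}^d$ is a direct sum of one-dimensional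 Bergman fans $B_1,\dots,B_s$ if $\mathbb{Z}^d=N_1\oplus\dots\oplus N_s$, each $B_i$ is a one-dimensional Bergman fan in $N_i$, and the fan is the sum (union of rays with their weights) of the $B_i$. *)

theory Defs
  imports "Jordan_Normal_Form.VS_Connect"
begin

text \<open>
  Since the dimensions \<open>d\<close> and \<open>r\<close> of the target spaces are quantified inside the theorem, the space
  $R^n$ is the carrier \<open>carrier_vec n\<close> of real vectors of length \<open>n\<close>.  Maps out of it are total HOL
  functions of which only the values on \<open>carrier_vec n\<close> are meaningful.
\<close>

abbreviation real_space :: "nat \<Rightarrow> (real, real vec) module" where
  "real_space n \<equiv> module_vec TYPE(real) n"

abbreviation vsum :: "nat \<Rightarrow> ('a \<Rightarrow> real vec) \<Rightarrow> 'a set \<Rightarrow> real vec" where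
  "vsum n \<equiv> finsum_vec TYPE(real) n"

definition int_lattice :: "nat \<Rightarrow> real vec set" where
  "int_lattice n = {v \<in> carrier_vec n. \<forall>i<n. v $ i \<in> \<int>}"

definition primitive_vec :: "nat \<Rightarrow> real vec \<Rightarrow> bool" where
  "primitive_vec n v \<longleftrightarrow> v \<in> int_lattice n \<and> v \<noteq> 0\<^sub>v n \<and>
     (\<forall>w \<in> int_lattice n. \<forall>m::nat. v = of_nat m \<cdot>\<^sub>v w \<longrightarrow> m = 1)"

definition int_linear_map :: "nat \<Rightarrow> nat \<Rightarrow> (real vec \<Rightarrow> real vec) \<Rightarrow> bool" where
  "int_linear_map n r \<pi> \<longleftrightarrow>
     linear_map class_ring (real_space n) (real_space r) \<pi> \<and> \<pi> ` int_lattice n \<subseteq> int_lattice r"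

definition int_linear_form :: "nat \<Rightarrow> (real vec \<Rightarrow> real) \<Rightarrow> bool" where
  "int_linear_form n l \<longleftrightarrow>
     (\<forall>x \<in> carrier_vec n. \<forall>y \<in> carrier_vec n. l (x + y) = l x + l y) \<and>
     (\<forall>c. \<forall>x \<in> carrier_vec n. l (c \<cdot>\<^sub>v x) = c * l x) \<and>
     l ` int_lattice n \<subseteq> \<int>"

definition nonneg_TR :: "nat \<Rightarrow> (real vec \<Rightarrow> real) \<Rightarrow> bool" where
  "nonneg_TR n M \<longleftrightarrow> (\<exists>L. finite L \<and> (\<forall>l \<in> L. int_linear_form n l) \<and>
     (\<forall>x \<in> carrier_vec n. M x = Max (insert 0 ((\<lambda>l. l x) ` L))))"

text \<open>
  A ray is represented by its primitive generator; the weight function is meaningful on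
  \<open>rays\<close> only.
\<close>

record fan =
  rays :: "real vec set"
  weight :: "real vec \<Rightarrow> nat"

definition tropical_fan :: "nat \<Rightarrow> fan \<Rightarrow> bool" where
  "tropical_fan n F \<longleftrightarrow> finite (rays F) \<and>
     (\<forall>v \<in> rays F. primitive_vec n v \<and> weight F v > 0) \<and>
     vsum n (\<lambda>v. of_nat (weight F v) \<cdot>\<^sub>v v) (rays F) = 0\<^sub>v n"

definition fan_span :: "nat \<Rightarrow> fan \<Rightarrow> real vec set" where
  "fan_span n F = LinearCombinations.module.span class_ring (real_space n) (rays F)"

definition fan_span_dim :: "nat \<Rightarrow> fan \<Rightarrow> nat" where
  "fan_span_dim n F = vectorspace.dim class_ring (real_space n \<lparr>carrier := fan_span n F\<rparr>)"

definition intersection_number :: "(real vec \<Rightarrow> real) \<Rightarrow> fan \<Rightarrow> real" where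
  "intersection_number M F = (\<Sum>v \<in> rays F. of_nat (weight F v) * M v)"

definition regular_sequence :: "nat \<Rightarrow> fan \<Rightarrow> (real vec \<Rightarrow> real) \<Rightarrow> bool" where
  "regular_sequence n F M \<longleftrightarrow> nonneg_TR n M \<and> intersection_number M F = 1"

definition regular_fan :: "nat \<Rightarrow> fan \<Rightarrow> bool" where
  "regular_fan n F \<longleftrightarrow> (\<exists>M. regular_sequence n F M)"

text \<open>
  The factor \<open>m\<close> below is taken in \<open>nat\<close>: if \<open>\<pi> v\<close> is integral and \<open>u\<close> is primitive, every real
  \<open>m > 0\<close> with \<open>\<pi> v = m u\<close> is an integer.  It is unique, so each \<open>v\<close> occurs at most once in the sum.
\<close>

definition push_forward :: "nat \<Rightarrow> (real vec \<Rightarrow> real vec) \<Rightarrow> fan \<Rightarrow> fan" where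
  "push_forward r \<pi> F =
     \<lparr>rays = {u. primitive_vec r u \<and> (\<exists>v \<in> rays F. \<exists>m::nat. 0 < m \<and> \<pi> v = of_nat m \<cdot>\<^sub>v u)},
      weight = (\<lambda>u. \<Sum>(v, m) \<in> {(v, m). v \<in> rays F \<and> 0 < m \<and> \<pi> v = of_nat m \<cdot>\<^sub>v u}. weight F v * m)\<rparr>"

definition lattice_basis :: "nat \<Rightarrow> real vec set \<Rightarrow> nat \<Rightarrow> (nat \<Rightarrow> real vec) \<Rightarrow> bool" where
  "lattice_basis d N k u \<longleftrightarrow>
     (\<forall>i \<in> {1..k}. u i \<in> carrier_vec d) \<and>
     N = {vsum d (\<lambda>i. of_int (c i) \<cdot>\<^sub>v u i) {1..k} | c. True} \<and>
     (\<forall>c :: nat \<Rightarrow> int. vsum d (\<lambda>i. of_int (c i) \<cdot>\<^sub>v u i) {1..k} = 0\<^sub>v d \<longrightarrow> (\<forall>i \<in> {1..k}. c i = 0))"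

definition bergman_fan :: "nat \<Rightarrow> real vec set \<Rightarrow> fan \<Rightarrow> bool" where
  "bergman_fan d N B \<longleftrightarrow> (\<exists>k\<ge>1. \<exists>u. lattice_basis d N k u \<and> u 0 = - vsum d u {1..k} \<and>
     rays B = u ` {0..k} \<and> (\<forall>v \<in> rays B. weight B v = 1))"

text \<open>
  In \<open>bergman_direct_sum\<close> each \<open>N i\<close> is a subgroup of the integer lattice, because
  \<open>bergman_fan\<close> makes it the integer span of a basis.
\<close>

definition lattice_direct_sum :: "nat \<Rightarrow> nat \<Rightarrow> (nat \<Rightarrow> real vec set) \<Rightarrow> bool" where
  "lattice_direct_sum d s N \<longleftrightarrow>
     (\<forall>i \<in> {1..s}. N i \<subseteq> int_lattice d) \<and>
     (\<forall>z \<in> int_lattice d. \<exists>!x. x \<in> Pi\<^sub>E {1..s} N \<and> vsum d x {1..s} = z)"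

definition bergman_direct_sum :: "nat \<Rightarrow> fan \<Rightarrow> bool" where
  "bergman_direct_sum d F \<longleftrightarrow> (\<exists>s\<ge>1. \<exists>N B.
     lattice_direct_sum d s N \<and> (\<forall>i \<in> {1..s}. bergman_fan d (N i) (B i)) \<and>
     rays F = (\<Union>i \<in> {1..s}. rays (B i)) \<and>
     (\<forall>v \<in> rays F. weight F v = (\<Sum>i \<in> {i \<in> {1..s}. v \<in> rays (B i)}. weight (B i) v)))"

definition universal_bergman_map :: "nat \<Rightarrow> fan \<Rightarrow> nat \<Rightarrow> (real vec \<Rightarrow> real vec) \<Rightarrow> bool" where
  "universal_bergman_map n F d \<pi>F \<longleftrightarrow>
     int_linear_map n d \<pi>F \<and> bergman_direct_sum d (push_forward d \<pi>F F) \<and>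
     (\<forall>r \<pi>. int_linear_map n r \<pi> \<and> bergman_direct_sum r (push_forward r \<pi> F) \<longrightarrow>
        (\<exists>\<psi>. int_linear_map d r \<psi> \<and> (\<forall>x \<in> carrier_vec n. \<pi> x = \<psi> (\<pi>F x))))"

end

theory Submission
  imports Defs
begin

text \<open>
  Only the forms \<open>l\<close> with \<open>max(0, l) \<cdot> F = 1\<close> matter. Since all terms of an intersection number are
  natural numbers and since, by balancing, \<open>max(0, -l)\<close> has the same intersection number as
  \<open>max(0, l)\<close>, such a form is \<open>1\<close> on one ray, \<open>-1\<close> on another ray, both of weight one, and \<open>0\<close> on all
  the others. Joining these two rays gives an equivalence relation on the rays of weight one. Choosing
  a base ray in each class, the forms joining the remaining rays to their base rays are the coordinates
  of \<open>\<pi>\<^sub>F\<close>, and each class with at least two rays is mapped bijectively to the rays of one Bergman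
  fan. Conversely, if the push-forward of \<open>F\<close> under \<open>\<pi>\<close> is a direct sum of Bergman fans, then
  the coordinates of \<open>\<pi>\<close> in the Bergman bases are such forms by the projection formula, hence they
  are integer combinations of the coordinates of \<open>\<pi>\<^sub>F\<close>. A non-negative TR function with
  intersection number one is the maximum of \<open>0\<close> and such forms, so it factors through \<open>\<pi>\<^sub>F\<close>.
\<close>

section \<open>Integral vectors, forms and maps\<close>

text \<open>Since the rays span, a linear form is determined by its values on them. A form with
  intersection number one is thus determined by an ordered pair of rays, and relations between pairs
  become identities of forms: the form of (v, w) is the form of (v, base) minus the form of (w,
  base). This is why the coordinates relative to base rays generate all these forms over the
  integers. The obstacle is arithmetic: whether an integral form with the values 1, -1 and 0 exists
  depends on the position of the rays in the lattice. Existence is therefore built into the relation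
  between rays, and sums and negatives of forms make it an equivalence. Rays of larger weight and
  rays linked only to themselves are sent to zero. In part 2 the universal map is arbitrary; the
  constructed map factors through it, so forms in the constructed coordinates are also functions of
  the given map.\<close>

lemma int_linear_map_iff:
  "int_linear_map n r \<pi> \<longleftrightarrow>
     (\<forall>x \<in> carrier_vec n. \<pi> x \<in> carrier_vec r) \<and>
     (\<forall>x \<in> carrier_vec n. \<forall>y \<in> carrier_vec n. \<pi> (x + y) = \<pi> x + \<pi> y) \<and>
     (\<forall>c. \<forall>x \<in> carrier_vec n. \<pi> (c \<cdot>\<^sub>v x) = c \<cdot>\<^sub>v \<pi> x) \<and>
     (\<forall>x \<in> int_lattice n. \<pi> x \<in> int_lattice r)"
proof -
  interpret V: vec_space "TYPE(real)" n .
  interpret W: vec_space "TYPE(real)" r .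
  have "vectorspace class_ring (real_space n)" "vectorspace class_ring (real_space r)"
    by (rule V.vectorspace_axioms, rule W.vectorspace_axioms)
  then have "linear_map class_ring (real_space n) (real_space r) \<pi> \<longleftrightarrow>
      \<pi> \<in> LinearCombinations.module_hom class_ring (real_space n) (real_space r)"
    by (auto simp: linear_map_def mod_hom_def mod_hom_axioms_def vectorspace_def)
  then show ?thesis
    unfolding int_linear_map_def
    by (auto simp: LinearCombinations.module_hom_def module_vec_simps)
qed

lemma int_lattice_carrier: "v \<in> int_lattice n \<Longrightarrow> v \<in> carrier_vec n"
  by (simp add: int_lattice_def)

lemma scalar_prod_Ints:
  assumes "a \<in> int_lattice n" "x \<in> int_lattice n"
  shows "a \<bullet> x \<in> \<int>"
  using assms unfolding int_lattice_def scalar_prod_def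
  by (auto intro!: Ints_sum Ints_mult)

lemma int_lattice_closed:
  shows "0\<^sub>v n \<in> int_lattice n"
    and "v \<in> int_lattice n \<Longrightarrow> - v \<in> int_lattice n"
    and "v \<in> int_lattice n \<Longrightarrow> w \<in> int_lattice n \<Longrightarrow> v + w \<in> int_lattice n"
    and "v \<in> int_lattice n \<Longrightarrow> w \<in> int_lattice n \<Longrightarrow> v - w \<in> int_lattice n"
    and "c \<in> \<int> \<Longrightarrow> v \<in> int_lattice n \<Longrightarrow> c \<cdot>\<^sub>v v \<in> int_lattice n"
  by (auto simp: int_lattice_def)

lemma unit_vec_int_lattice: "unit_vec n i \<in> int_lattice n"
  by (auto simp: int_lattice_def unit_vec_def)

lemma vsum_closed: "f \<in> A \<rightarrow> carrier_vec n \<Longrightarrow> vsum n f A \<in> carrier_vec n"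
  by (rule finsum_vec_closed)

lemma vsum_int_lattice:
  assumes "finite A" "f \<in> A \<rightarrow> int_lattice n"
  shows "vsum n f A \<in> int_lattice n"
proof -
  have "f \<in> A \<rightarrow> carrier_vec n" using assms(2) by (auto dest: int_lattice_carrier)
  then show ?thesis
    using assms vsum_closed[of f A n]
    by (auto simp: int_lattice_def index_finsum_vec intro!: Ints_sum)
qed

lemma int_linear_form_scalar_prod:
  "a \<in> int_lattice n \<Longrightarrow> int_linear_form n (\<lambda>x. a \<bullet> x)"
  unfolding int_linear_form_def
  by (auto simp: scalar_prod_Ints scalar_prod_add_distrib[of _ n] dest: int_lattice_carrier)

lemma vsum_unit_vec:
  assumes "x \<in> carrier_vec n"
  shows "vsum n (\<lambda>i. x $ i \<cdot>\<^sub>v unit_vec n i) {..<n} = x"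
  using assms vsum_closed[of "\<lambda>i. x $ i \<cdot>\<^sub>v unit_vec n i" "{..<n}" n]
  by (intro eq_vecI) (auto simp: index_finsum_vec sum.If_cases if_distrib[where f = "times _"] cong: if_cong)

lemma additive_vsum:
  fixes l :: "real vec \<Rightarrow> real"
  assumes "\<And>x y. x \<in> carrier_vec n \<Longrightarrow> y \<in> carrier_vec n \<Longrightarrow> l (x + y) = l x + l y"
    and "l (0\<^sub>v n) = 0" "finite A" "f \<in> A \<rightarrow> carrier_vec n"
  shows "l (vsum n f A) = (\<Sum>i\<in>A. l (f i))"
  using assms(3,4)
proof (induct A)
  case empty
  then show ?case using assms(2) by (simp add: finsum_vec_empty)
next
  case (insert i A)
  then have "f i \<in> carrier_vec n" "vsum n f A \<in> carrier_vec n" by (auto intro: vsum_closed)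
  then show ?case using insert by (simp add: finsum_vec_insert assms(1))
qed

lemma scalar_prod_vsum:
  assumes "finite A" "f \<in> A \<rightarrow> carrier_vec n" "a \<in> carrier_vec n"
  shows "a \<bullet> vsum n f A = (\<Sum>i\<in>A. a \<bullet> f i)"
  by (rule additive_vsum[of n "\<lambda>x. a \<bullet> x"])
    (use assms in \<open>auto simp: scalar_prod_add_distrib[of _ n]\<close>)

text \<open>The coefficients are the values on the unit vectors, which are integers because unit
  vectors are lattice points. This lets every form be handled as a lattice vector paired by the
  scalar product.\<close>

lemma int_linear_form_vec:
  assumes "int_linear_form n l"
  shows "\<exists>a\<in>int_lattice n. \<forall>x\<in>carrier_vec n. l x = a \<bullet> x"
proof (intro bexI ballI)
  let ?a = "vec n (\<lambda>i. l (unit_vec n i))"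
  show "?a \<in> int_lattice n"
    using assms unit_vec_int_lattice[of n] unfolding int_linear_form_def
    by (auto simp: int_lattice_def)
  fix x :: "real vec" assume x: "x \<in> carrier_vec n"
  have l: "\<And>x y. x \<in> carrier_vec n \<Longrightarrow> y \<in> carrier_vec n \<Longrightarrow> l (x + y) = l x + l y"
    "\<And>c x. x \<in> carrier_vec n \<Longrightarrow> l (c \<cdot>\<^sub>v x) = c * l x"
    using assms by (auto simp: int_linear_form_def)
  have "0 \<cdot>\<^sub>v 0\<^sub>v n = (0\<^sub>v n :: real vec)" by auto
  then have l0: "l (0\<^sub>v n) = 0" using l(2)[of "0\<^sub>v n" 0] by simp
  have "l x = l (vsum n (\<lambda>i. x $ i \<cdot>\<^sub>v unit_vec n i) {..<n})"
    using x by (simp add: vsum_unit_vec)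
  also have "\<dots> = (\<Sum>i<n. l (x $ i \<cdot>\<^sub>v unit_vec n i))"
    by (rule additive_vsum[OF l(1) l0]) auto
  also have "\<dots> = ?a \<bullet> x"
    using x by (simp add: l scalar_prod_def lessThan_atLeast0 mult.commute)
  finally show "l x = ?a \<bullet> x" .
qed

text \<open>The kernel of \<open>a\<close> is a submodule that contains the rays, hence their span.
  The spanning hypothesis enters the whole proof through this fact.\<close>

lemma fan_span_orthogonal:
  assumes "fan_span n F = carrier_vec n" "rays F \<subseteq> carrier_vec n" "a \<in> carrier_vec n"
    and "\<And>v. v \<in> rays F \<Longrightarrow> a \<bullet> v = 0" "x \<in> carrier_vec n"
  shows "a \<bullet> x = 0"
proof -
  interpret V: vec_space "TYPE(real)" n .
  let ?N = "{x \<in> carrier_vec n. a \<bullet> x = 0}"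
  have "submodule class_ring ?N (real_space n)"
    using assms(3)
    by (intro submodule.intro V.module_axioms)
      (auto simp: module_vec_simps scalar_prod_add_distrib[of _ n])
  from V.span_is_subset[OF _ this, of "rays F"] assms show ?thesis
    unfolding fan_span_def by auto
qed

lemma vec_eq_by_rays:
  assumes "fan_span n F = carrier_vec n" "rays F \<subseteq> carrier_vec n"
    and "a \<in> carrier_vec n" "b \<in> carrier_vec n" "x \<in> carrier_vec n"
    and "\<And>v. v \<in> rays F \<Longrightarrow> a \<bullet> v = b \<bullet> v"
  shows "a \<bullet> x = b \<bullet> x"
proof -
  have "(a - b) \<bullet> v = a \<bullet> v - b \<bullet> v" if "v \<in> carrier_vec n" for v
    using assms(3,4) that by (simp add: minus_scalar_prod_distrib[of _ n])
  then show ?thesis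
    using fan_span_orthogonal[OF assms(1,2), of "a - b" x] assms(2-6)
    by (metis (no_types, lifting) minus_carrier_vec diff_self eq_iff_diff_eq_0 subsetD)
qed

lemma tropical_fan_rays:
  assumes "tropical_fan n F"
  shows "finite (rays F)" "rays F \<subseteq> int_lattice n" "rays F \<subseteq> carrier_vec n"
    "\<And>v. v \<in> rays F \<Longrightarrow> weight F v > 0"
  using assms by (auto simp: tropical_fan_def primitive_vec_def int_lattice_def)

text \<open>Balancing, paired with a form: the positive and the negative values of the form have the
  same weighted total.\<close>

lemma tropical_fan_balance:
  assumes "tropical_fan n F" "a \<in> carrier_vec n"
  shows "(\<Sum>v\<in>rays F. of_nat (weight F v) * (a \<bullet> v)) = 0"
proof -
  note R = tropical_fan_rays[OF assms(1)]
  have "(\<Sum>v\<in>rays F. of_nat (weight F v) * (a \<bullet> v)) = (\<Sum>v\<in>rays F. a \<bullet> (of_nat (weight F v) \<cdot>\<^sub>v v))"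
    using R(3) assms(2) by (intro sum.cong) auto
  also have "\<dots> = a \<bullet> vsum n (\<lambda>v. of_nat (weight F v) \<cdot>\<^sub>v v) (rays F)"
    using R assms(2) by (subst scalar_prod_vsum) auto
  also have "\<dots> = 0" using assms by (simp add: tropical_fan_def)
  finally show ?thesis .
qed

section \<open>The projection formula\<close>

text \<open>A nonzero entry of \<open>v\<close> bounds its integer divisors: if \<open>v\<close> is
  \<open>m\<close> times an integral \<open>w\<close>, that entry of \<open>w\<close> has absolute
  value at least 1. The quotient by the largest divisor is primitive, as a further factor
  \<open>k\<close> would give the larger divisor \<open>m * k\<close>.\<close>

lemma primitive_decomposition:
  assumes "v \<in> int_lattice r" "v \<noteq> 0\<^sub>v r"
  obtains u and m :: nat where "primitive_vec r u" "m > 0" "v = of_nat m \<cdot>\<^sub>v u"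
proof -
  let ?S = "{m::nat. \<exists>w\<in>int_lattice r. v = of_nat m \<cdot>\<^sub>v w}"
  obtain i where i: "i < r" "v $ i \<noteq> 0"
    using assms by (metis eq_vecI index_zero_vec int_lattice_carrier carrier_vecD)
  have "m \<le> nat \<lceil>\<bar>v $ i\<bar>\<rceil>" if m: "m \<in> ?S" for m
  proof -
    obtain w where w: "w \<in> int_lattice r" "v = of_nat m \<cdot>\<^sub>v w" using m by blast
    then have "v $ i = real m * w $ i" "w $ i \<in> \<int>" using i(1) by (auto simp: int_lattice_def)
    moreover from this have "1 \<le> \<bar>w $ i\<bar>" using i(2) by (intro Ints_nonzero_abs_ge1) auto
    ultimately have "real m \<le> \<bar>v $ i\<bar>" by (simp add: abs_mult mult_le_cancel_left1)
    then show ?thesis by linarith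
  qed
  then have fin: "finite ?S" by (meson finite_nat_set_iff_bounded_le)
  have "v = of_nat 1 \<cdot>\<^sub>v v" by simp
  then have one: "1 \<in> ?S" using assms(1) by blast
  define m where "m = Max ?S"
  have m1: "1 \<le> m" unfolding m_def by (rule Max_ge[OF fin one])
  have "m \<in> ?S" unfolding m_def using fin one Max_in by blast
  then obtain u where u: "u \<in> int_lattice r" "v = of_nat m \<cdot>\<^sub>v u" by blast
  have u0: "u \<noteq> 0\<^sub>v r" using u assms(2) by auto
  have "primitive_vec r u" unfolding primitive_vec_def
  proof (intro conjI ballI allI impI u u0)
    fix w and k :: nat assume w: "w \<in> int_lattice r" "u = of_nat k \<cdot>\<^sub>v w"
    have "v = of_nat (m * k) \<cdot>\<^sub>v w" using u(2) w(2) by (simp add: smult_smult_assoc)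
    then have "m * k \<in> ?S" using w(1) by blast
    then have "m * k \<le> m" unfolding m_def by (rule Max_ge[OF fin])
    \<comment> \<open>The bound \<open>m * k \<le> m\<close> admits the factor 0, which is excluded
      separately because \<open>u\<close> is nonzero.\<close>
    moreover have "k \<noteq> 0" using w u0 int_lattice_carrier[OF w(1)] by (intro notI) auto
    ultimately show "k = 1" using m1 by (cases k) auto
  qed
  then show thesis using that[of u m] u(2) m1 by auto
qed

text \<open>Bezout: with x a + y b = 1 and b w = a u one gets w = a (x w + y u), so \<open>a\<close>
  divides \<open>w\<close> in the lattice and primitivity leaves only \<open>a = 1\<close>.\<close>

lemma coprime_primitive_multiple:
  fixes a b :: nat
  assumes "coprime a b" "u \<in> int_lattice r" "primitive_vec r w"
    and "of_nat a \<cdot>\<^sub>v u = of_nat b \<cdot>\<^sub>v w"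
  shows "a = 1"
proof -
  obtain x y :: int where xy: "x * int a + y * int b = 1"
    using assms(1) bezout_int[of "int a" "int b"]
    by (auto simp: coprime_iff_gcd_eq_1)
  let ?z = "of_int x \<cdot>\<^sub>v w + of_int y \<cdot>\<^sub>v u"
  have w: "w \<in> int_lattice r" using assms(3) by (simp add: primitive_vec_def)
  have z: "?z \<in> int_lattice r" using w assms(2) by (intro int_lattice_closed) auto
  have xy': "of_int x * real a + of_int y * real b = (1::real)"
    using arg_cong[OF xy, of real_of_int] by simp
  have "w = of_nat a \<cdot>\<^sub>v ?z"
  proof (rule eq_vecI)
    show d: "dim_vec w = dim_vec (of_nat a \<cdot>\<^sub>v ?z)"
      using w assms(2) by (auto simp: int_lattice_def)
    fix i assume "i < dim_vec (of_nat a \<cdot>\<^sub>v ?z)"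
    then have i: "i < r" using assms(2) by (auto simp: int_lattice_def)
    have e: "real a * u $ i = real b * w $ i"
      using arg_cong[OF assms(4), of "\<lambda>v. v $ i"] i w assms(2) by (auto simp: int_lattice_def)
    have "w $ i = (of_int x * real a + of_int y * real b) * w $ i" using xy' by simp
    also have "\<dots> = of_int x * real a * w $ i + of_int y * (real b * w $ i)"
      by (simp add: algebra_simps)
    also have "\<dots> = real a * (of_int x * w $ i + of_int y * u $ i)"
      unfolding e[symmetric] by (simp add: algebra_simps)
    finally show "w $ i = (of_nat a \<cdot>\<^sub>v ?z) $ i"
      using i w assms(2) by (auto simp: int_lattice_def)
  qed
  then show ?thesis using assms(3) z unfolding primitive_vec_def by blast
qed

text \<open>After division by the gcd the two factors are coprime; the Bezout argument, used in both
  directions, makes each of them 1, so \<open>a\<close> and \<open>b\<close> both equal the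
  gcd.\<close>

lemma primitive_decomposition_unique:
  fixes a b :: nat
  assumes "primitive_vec r u" "primitive_vec r w" "a > 0" "b > 0"
    and eq: "of_nat a \<cdot>\<^sub>v u = of_nat b \<cdot>\<^sub>v w"
  shows "a = b \<and> u = w"
proof -
  have uw: "u \<in> int_lattice r" "w \<in> int_lattice r" using assms by (auto simp: primitive_vec_def)
  obtain g a' b' where g: "g = gcd a b" "a = a' * g" "b = b' * g" "coprime a' b'"
    using gcd_coprime_exists[of a b] assms(3) by (metis gcd_eq_0_iff less_numeral_extra(3))
  have g0: "g > 0" using g(1) assms(3) by auto
  have eq': "of_nat a' \<cdot>\<^sub>v u = of_nat b' \<cdot>\<^sub>v w"
  proof (rule eq_vecI)
    fix i assume "i < dim_vec (of_nat b' \<cdot>\<^sub>v w)"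
    then have i: "i < dim_vec u" "i < dim_vec w" using uw by (auto simp: int_lattice_def)
    then have "real a * u $ i = real b * w $ i"
      using arg_cong[OF eq, of "\<lambda>v. v $ i"] by simp
    then show "(of_nat a' \<cdot>\<^sub>v u) $ i = (of_nat b' \<cdot>\<^sub>v w) $ i"
      using i g0 by (simp add: g(2,3))
  qed (use uw in \<open>auto simp: int_lattice_def\<close>)
  have "a' = 1" by (rule coprime_primitive_multiple[OF g(4) uw(1) assms(2) eq'])
  moreover have "b' = 1"
    using coprime_primitive_multiple[OF _ uw(2) assms(1) eq'[symmetric]] g(4)
    by (simp add: coprime_commute)
  ultimately show ?thesis using g eq' by simp
qed

text \<open>The projection formula. Group the rays by the primitive generator \<open>u\<close> of
  their image: if the image of \<open>v\<close> is \<open>m\<close> times \<open>u\<close>,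
  homogeneity moves the factor \<open>m\<close> from the weight into the argument of
  \<open>M\<close>. Homogeneity under natural factors is the right assumption because
  \<open>M\<close> will be a maximum of forms, which is not additive.\<close>

lemma intersection_number_push_forward:
  assumes fin: "finite (rays F)"
    and \<pi>: "\<And>v. v \<in> rays F \<Longrightarrow> \<pi> v \<in> int_lattice r"
    and M0: "M (0\<^sub>v r) = 0"
    and hom: "\<And>(m::nat) u. u \<in> carrier_vec r \<Longrightarrow> M (of_nat m \<cdot>\<^sub>v u) = of_nat m * M u"
  shows "intersection_number M (push_forward r \<pi> F) = intersection_number (\<lambda>v. M (\<pi> v)) F"
proof -
  let ?R = "{v \<in> rays F. \<pi> v \<noteq> 0\<^sub>v r}"
  have "\<exists>q. primitive_vec r (fst q) \<and> (snd q :: nat) > 0 \<and> \<pi> v = of_nat (snd q) \<cdot>\<^sub>v fst q"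
    if "v \<in> ?R" for v
  proof -
    have v: "\<pi> v \<in> int_lattice r" "\<pi> v \<noteq> 0\<^sub>v r" using \<pi> that by auto
    show ?thesis by (rule primitive_decomposition[OF v]) auto
  qed
  then have "\<forall>v\<in>?R. \<exists>q. primitive_vec r (fst q) \<and> (snd q :: nat) > 0 \<and> \<pi> v = of_nat (snd q) \<cdot>\<^sub>v fst q"
    by blast
  from bchoice[OF this] obtain q where q: "\<forall>v\<in>?R. primitive_vec r (fst (q v)) \<and> (snd (q v) :: nat) > 0
      \<and> \<pi> v = of_nat (snd (q v)) \<cdot>\<^sub>v fst (q v)" ..
  define p k where "p v = fst (q v)" and "k v = snd (q v)" for v
  have pk: "\<And>v. v \<in> ?R \<Longrightarrow> primitive_vec r (p v)" "\<And>v. v \<in> ?R \<Longrightarrow> k v > 0"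
      "\<And>v. v \<in> ?R \<Longrightarrow> \<pi> v = of_nat (k v) \<cdot>\<^sub>v p v"
    using q unfolding p_def k_def by blast+
  have nz: "\<pi> v \<noteq> 0\<^sub>v r" if h: "primitive_vec r u" "(m::nat) > 0" "\<pi> v = of_nat m \<cdot>\<^sub>v u" for u m v
  proof
    assume z: "\<pi> v = 0\<^sub>v r"
    have u: "u \<in> carrier_vec r" "u \<noteq> 0\<^sub>v r"
      using h(1) by (auto simp: primitive_vec_def int_lattice_def)
    have "u $ i = 0" if i: "i < r" for i
      using arg_cong[OF h(3)[unfolded z], of "\<lambda>v. v $ i"] i u(1) h(2) by simp
    then have "u = 0\<^sub>v r" using u(1) by (intro eq_vecI) auto
    with u show False by simp
  qed
  have uniq: "v \<in> ?R \<and> m = k v \<and> u = p v"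
    if "primitive_vec r u" "v \<in> rays F" "(m::nat) > 0" "\<pi> v = of_nat m \<cdot>\<^sub>v u" for u m v
  proof -
    have v: "v \<in> ?R" using nz that by auto
    then show ?thesis
      using primitive_decomposition_unique[OF that(1) pk(1)[OF v] that(3) pk(2)[OF v]] pk(3)[OF v] that(4)
      by simp
  qed
  have rays: "rays (push_forward r \<pi> F) = p ` ?R"
  proof (intro equalityI subsetI)
    fix u assume "u \<in> rays (push_forward r \<pi> F)"
    then obtain v and m :: nat where "primitive_vec r u" "v \<in> rays F" "m > 0" "\<pi> v = of_nat m \<cdot>\<^sub>v u"
      unfolding push_forward_def by auto
    from uniq[OF this] show "u \<in> p ` ?R" by blast
  next
    fix u assume "u \<in> p ` ?R"
    then obtain v where v: "v \<in> ?R" "u = p v" by blast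
    then show "u \<in> rays (push_forward r \<pi> F)"
      using pk(1)[OF v(1)] pk(2)[OF v(1)] pk(3)[OF v(1)] unfolding push_forward_def by auto
  qed
  \<comment> \<open>The weight is a sum over pairs \<open>(v, m)\<close>; since \<open>m\<close> is
    determined by \<open>v\<close>, it becomes a sum over the fibre of \<open>p\<close>.\<close>
  have wt: "real (weight (push_forward r \<pi> F) u) = (\<Sum>v\<in>{v\<in>?R. p v = u}. real (weight F v * k v))"
    if u: "u \<in> p ` ?R" for u
  proof -
    have pu: "primitive_vec r u" using u pk(1) by auto
    have "{(v, m). v \<in> rays F \<and> 0 < m \<and> \<pi> v = of_nat m \<cdot>\<^sub>v u} = (\<lambda>v. (v, k v)) ` {v\<in>?R. p v = u}"
    proof (intro equalityI subsetI)
      fix x assume "x \<in> {(v, m). v \<in> rays F \<and> 0 < m \<and> \<pi> v = of_nat m \<cdot>\<^sub>v u}"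
      then obtain v m where "x = (v, m)" "v \<in> rays F" "0 < m" "\<pi> v = of_nat m \<cdot>\<^sub>v u" by blast
      with uniq[OF pu this(2-4)] show "x \<in> (\<lambda>v. (v, k v)) ` {v\<in>?R. p v = u}" by blast
    next
      fix x assume "x \<in> (\<lambda>v. (v, k v)) ` {v\<in>?R. p v = u}"
      then obtain v where v: "x = (v, k v)" "v \<in> ?R" "p v = u" by blast
      then show "x \<in> {(v, m). v \<in> rays F \<and> 0 < m \<and> \<pi> v = of_nat m \<cdot>\<^sub>v u}"
        using pk(2)[OF v(2)] pk(3)[OF v(2)] by blast
    qed
    moreover have "inj_on (\<lambda>v. (v, k v)) {v\<in>?R. p v = u}" by (auto intro: inj_onI)
    ultimately show ?thesis
      unfolding push_forward_def by (simp add: sum.reindex del: of_nat_mult)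
  qed
  have "intersection_number M (push_forward r \<pi> F)
      = (\<Sum>u\<in>p ` ?R. \<Sum>v\<in>{v\<in>?R. p v = u}. real (weight F v) * M (\<pi> v))"
    unfolding intersection_number_def rays
  proof (rule sum.cong[OF refl])
    fix u assume u: "u \<in> p ` ?R"
    then have uc: "u \<in> carrier_vec r" using pk(1) by (auto simp: primitive_vec_def int_lattice_def)
    show "real (weight (push_forward r \<pi> F) u) * M u
        = (\<Sum>v\<in>{v\<in>?R. p v = u}. real (weight F v) * M (\<pi> v))"
      unfolding wt[OF u] sum_distrib_right
    proof (intro sum.cong refl)
      fix v assume v: "v \<in> {v\<in>?R. p v = u}"
      then have "\<pi> v = of_nat (k v) \<cdot>\<^sub>v u" using pk(3)[of v] by simp
      then show "real (weight F v * k v) * M u = real (weight F v) * M (\<pi> v)"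
        by (simp add: hom[OF uc])
    qed
  qed
  also have "\<dots> = (\<Sum>v\<in>?R. real (weight F v) * M (\<pi> v))"
    using fin by (intro sum.image_gen[symmetric]) auto
  \<comment> \<open>Rays with image zero have left no trace in the push-forward; they are added back
    here with the value \<open>M\<close> at zero, which is 0.\<close>
  also have "\<dots> = intersection_number (\<lambda>v. M (\<pi> v)) F"
    unfolding intersection_number_def
    using fin M0 by (intro sum.mono_neutral_left) auto
  finally show ?thesis .
qed

section \<open>Dual bases of direct sums of Bergman fans\<close>

lemma vsum_Sigma:
  assumes "finite A" "\<And>i. i \<in> A \<Longrightarrow> finite (B i)"
    and "\<And>i j. i \<in> A \<Longrightarrow> j \<in> B i \<Longrightarrow> f (i, j) \<in> carrier_vec n"
  shows "vsum n f (Sigma A B) = vsum n (\<lambda>i. vsum n (\<lambda>j. f (i, j)) (B i)) A"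
proof -
  have 1: "(\<lambda>i. vsum n (\<lambda>j. f (i, j)) (B i)) \<in> A \<rightarrow> carrier_vec n"
    using assms(3) by (auto intro!: vsum_closed)
  have 2: "f \<in> Sigma A B \<rightarrow> carrier_vec n" using assms(3) by auto
  show ?thesis
  proof (rule eq_vecI)
    fix l assume "l < dim_vec (vsum n (\<lambda>i. vsum n (\<lambda>j. f (i, j)) (B i)) A)"
    then have l: "l < n" using vsum_closed[OF 1] by auto
    have "vsum n f (Sigma A B) $ l = (\<Sum>q\<in>Sigma A B. f q $ l)"
      using 2 assms(1,2) l by (simp add: index_finsum_vec)
    also have "\<dots> = (\<Sum>i\<in>A. \<Sum>j\<in>B i. f (i, j) $ l)"
      using assms(1,2) by (simp add: sum.Sigma)
    also have "\<dots> = (\<Sum>i\<in>A. vsum n (\<lambda>j. f (i, j)) (B i) $ l)"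
      using assms l by (intro sum.cong) (auto simp: index_finsum_vec Pi_def)
    also have "\<dots> = vsum n (\<lambda>i. vsum n (\<lambda>j. f (i, j)) (B i)) A $ l"
      using 1 assms(1) l by (simp add: index_finsum_vec)
    finally show "vsum n f (Sigma A B) $ l = \<dots>" .
  qed (use vsum_closed[OF 1] vsum_closed[OF 2] in auto)
qed

lemma vsum_cong:
  assumes "\<And>i. i \<in> A \<Longrightarrow> f i = g i" "\<And>i. i \<in> A \<Longrightarrow> g i \<in> carrier_vec n" "finite A"
  shows "vsum n f A = vsum n g A"
proof -
  have 1: "f \<in> A \<rightarrow> carrier_vec n" "g \<in> A \<rightarrow> carrier_vec n" using assms by auto
  then show ?thesis
    using vsum_closed[OF 1(1)] vsum_closed[OF 1(2)] assms
    by (intro eq_vecI) (auto simp: index_finsum_vec intro!: sum.cong)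
qed

lemma vsum_single:
  assumes "finite A" "a \<in> A" "\<And>i. i \<in> A \<Longrightarrow> u i \<in> carrier_vec n"
  shows "vsum n (\<lambda>i. of_int (if i = a then 1 else 0) \<cdot>\<^sub>v u i) A = u a"
proof -
  have 1: "(\<lambda>i. of_int (if i = a then 1 else 0) \<cdot>\<^sub>v u i) \<in> A \<rightarrow> carrier_vec n" using assms by auto
  have "(\<Sum>i\<in>A. (of_int (if i = a then 1 else 0) \<cdot>\<^sub>v u i) $ l) = u a $ l" if "l < n" for l
  proof -
    have "(\<Sum>i\<in>A. (of_int (if i = a then 1 else 0) \<cdot>\<^sub>v u i) $ l) = (\<Sum>i\<in>A. if i = a then u i $ l else 0)"
      using that by (intro sum.cong) (auto simp: carrier_vecD[OF assms(3)])
    then show ?thesis using assms by simp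
  qed
  then show ?thesis
    using carrier_vecD[OF vsum_closed[OF 1]] carrier_vecD[OF assms(3)[OF assms(2)]]
    by (intro eq_vecI) (simp_all add: index_finsum_vec[OF assms(1) _ 1])
qed

lemma vsum_zero:
  assumes "finite A" "\<And>i. i \<in> A \<Longrightarrow> f i = 0\<^sub>v n"
  shows "vsum n f A = 0\<^sub>v n"
proof -
  have 1: "f \<in> A \<rightarrow> carrier_vec n" using assms by auto
  show ?thesis using vsum_closed[OF 1] assms 1 by (intro eq_vecI) (auto simp: index_finsum_vec)
qed

lemma lattice_basis_mem:
  assumes "lattice_basis d N k u" "j \<in> {1..k}"
  shows "u j \<in> N"
proof -
  have "u j = vsum d (\<lambda>i. of_int (if i = j then 1 else 0) \<cdot>\<^sub>v u i) {1..k}"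
    using assms by (intro vsum_single[symmetric]) (auto simp: lattice_basis_def)
  moreover have N: "N = {vsum d (\<lambda>i. of_int (c i) \<cdot>\<^sub>v u i) {1..k} | c. True}"
    using assms(1) by (simp add: lattice_basis_def)
  have "vsum d (\<lambda>i. of_int (if i = j then 1 else 0) \<cdot>\<^sub>v u i) {1..k} \<in> N"
    unfolding N by (rule CollectI, intro exI[of _ "\<lambda>i. if i = j then 1 else 0"] conjI TrueI refl)
  ultimately show ?thesis by simp
qed

text \<open>The bases of the summands together form a basis. The existence half of the unique
  decomposition gives generation; the uniqueness half, applied to a vanishing combination and the
  zero family, makes each block vanish, and independence inside the block finishes.\<close>

lemma lattice_direct_sum_basis:
  assumes ds: "lattice_direct_sum d s N"
    and lb: "\<forall>i\<in>{1..s}. lattice_basis d (N i) (k i) (U i)"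
  defines "J \<equiv> SIGMA i:{1..s}. {1..k i}" and "u \<equiv> \<lambda>(i, j). U i j"
  shows "\<forall>q\<in>J. u q \<in> int_lattice d"
    and "\<forall>z\<in>int_lattice d. \<exists>c :: nat \<times> nat \<Rightarrow> int. z = vsum d (\<lambda>q. of_int (c q) \<cdot>\<^sub>v u q) J"
    and "\<forall>c :: nat \<times> nat \<Rightarrow> int. vsum d (\<lambda>q. of_int (c q) \<cdot>\<^sub>v u q) J = 0\<^sub>v d \<longrightarrow> (\<forall>q\<in>J. c q = 0)"
proof -
  have NU: "N i = {vsum d (\<lambda>j. of_int (c j) \<cdot>\<^sub>v U i j) {1..k i} | c. True}" if "i \<in> {1..s}" for i
    using lb that by (simp add: lattice_basis_def)
  have NZ: "N i \<subseteq> int_lattice d" if "i \<in> {1..s}" for i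
    using ds that unfolding lattice_direct_sum_def by blast
  have ex: "\<exists>!x. x \<in> Pi\<^sub>E {1..s} N \<and> vsum d x {1..s} = z" if "z \<in> int_lattice d" for z
    using ds that unfolding lattice_direct_sum_def by blast
  show uZ: "\<forall>q\<in>J. u q \<in> int_lattice d"
  proof
    fix q assume "q \<in> J"
    then obtain i j where "q = (i, j)" "i \<in> {1..s}" "j \<in> {1..k i}" unfolding J_def by blast
    then show "u q \<in> int_lattice d" using lattice_basis_mem lb NZ by (fastforce simp: u_def)
  qed
  have Uc: "U i j \<in> carrier_vec d" if "i \<in> {1..s}" "j \<in> {1..k i}" for i j
    using uZ[rule_format, of "(i, j)"] that unfolding J_def u_def by (auto dest: int_lattice_carrier)
  have sig: "vsum d (\<lambda>q. of_int (c q) \<cdot>\<^sub>v u q) J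
      = vsum d (\<lambda>i. vsum d (\<lambda>j. of_int (c (i, j)) \<cdot>\<^sub>v U i j) {1..k i}) {1..s}" for c :: "nat \<times> nat \<Rightarrow> int"
    unfolding J_def u_def
    by (subst vsum_Sigma) (use Uc in auto)
  show "\<forall>z\<in>int_lattice d. \<exists>c :: nat \<times> nat \<Rightarrow> int. z = vsum d (\<lambda>q. of_int (c q) \<cdot>\<^sub>v u q) J"
  proof
    fix z assume z: "z \<in> int_lattice d"
    obtain x where x: "x \<in> Pi\<^sub>E {1..s} N" "vsum d x {1..s} = z" using ex[OF z] by blast
    have "\<forall>i\<in>{1..s}. \<exists>c :: nat \<Rightarrow> int. x i = vsum d (\<lambda>j. of_int (c j) \<cdot>\<^sub>v U i j) {1..k i}"
    proof
      fix i assume i: "i \<in> {1..s}"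
      then have "x i \<in> N i" using x(1) by auto
      then show "\<exists>c :: nat \<Rightarrow> int. x i = vsum d (\<lambda>j. of_int (c j) \<cdot>\<^sub>v U i j) {1..k i}"
        unfolding NU[OF i] by blast
    qed
    from bchoice[OF this] obtain c :: "nat \<Rightarrow> nat \<Rightarrow> int"
      where c: "\<forall>i\<in>{1..s}. x i = vsum d (\<lambda>j. of_int (c i j) \<cdot>\<^sub>v U i j) {1..k i}" ..
    have "vsum d x {1..s} = vsum d (\<lambda>i. vsum d (\<lambda>j. of_int (c i j) \<cdot>\<^sub>v U i j) {1..k i}) {1..s}"
      using c Uc by (intro vsum_cong) (auto intro!: vsum_closed)
    then have "z = vsum d (\<lambda>q. of_int (case q of (i, j) \<Rightarrow> c i j) \<cdot>\<^sub>v u q) J"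
      using sig[of "\<lambda>(i, j). c i j"] x(2) by simp
    then show "\<exists>c :: nat \<times> nat \<Rightarrow> int. z = vsum d (\<lambda>q. of_int (c q) \<cdot>\<^sub>v u q) J"
      by (rule exI[of _ "\<lambda>(i, j). c i j"])
  qed
  show "\<forall>c :: nat \<times> nat \<Rightarrow> int. vsum d (\<lambda>q. of_int (c q) \<cdot>\<^sub>v u q) J = 0\<^sub>v d \<longrightarrow> (\<forall>q\<in>J. c q = 0)"
  proof (intro allI impI ballI)
    fix c :: "nat \<times> nat \<Rightarrow> int" and q
    assume c: "vsum d (\<lambda>q. of_int (c q) \<cdot>\<^sub>v u q) J = 0\<^sub>v d" and q: "q \<in> J"
    obtain i j where ij: "q = (i, j)" "i \<in> {1..s}" "j \<in> {1..k i}" using q unfolding J_def by blast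
    let ?x = "\<lambda>i\<in>{1..s}. vsum d (\<lambda>j. of_int (c (i, j)) \<cdot>\<^sub>v U i j) {1..k i}"
    let ?o = "\<lambda>i\<in>{1..s}. 0\<^sub>v d :: real vec"
    have "?x \<in> Pi\<^sub>E {1..s} N"
      using NU by auto
    moreover have "vsum d ?x {1..s} = 0\<^sub>v d"
    proof -
      have "vsum d ?x {1..s} = vsum d (\<lambda>i. vsum d (\<lambda>j. of_int (c (i, j)) \<cdot>\<^sub>v U i j) {1..k i}) {1..s}"
        using Uc by (intro vsum_cong) (auto intro!: vsum_closed)
      then show ?thesis using c sig[of c] by simp
    qed
    moreover have "?o \<in> Pi\<^sub>E {1..s} N"
    proof (rule restrict_PiE_iff[THEN iffD2], rule ballI)
      fix i assume i: "i \<in> {1..s}"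
      have "vsum d (\<lambda>j. of_int 0 \<cdot>\<^sub>v U i j) {1..k i} = 0\<^sub>v d"
        by (intro vsum_zero) (auto intro!: eq_vecI simp: carrier_vecD[OF Uc[OF i]])
      then show "0\<^sub>v d \<in> N i" unfolding NU[OF i] by (intro CollectI exI[of _ "\<lambda>_. 0"]) simp
    qed
    moreover have "vsum d ?o {1..s} = 0\<^sub>v d" by (intro vsum_zero) auto
    ultimately have "?x = ?o" using ex[OF int_lattice_closed(1)] by blast
    from fun_cong[OF this, of i] have "vsum d (\<lambda>j. of_int (c (i, j)) \<cdot>\<^sub>v U i j) {1..k i} = 0\<^sub>v d"
      using ij by simp
    moreover have "lattice_basis d (N i) (k i) (U i)" using lb ij(2) by blast
    ultimately have "\<forall>j\<in>{1..k i}. c (i, j) = 0"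
      unfolding lattice_basis_def by (elim conjE allE[of _ "\<lambda>j. c (i, j)"]) simp
    then show "c q = 0" using ij by simp
  qed
qed

text \<open>The coefficients of the unit vectors in the basis form the inverse of the basis matrix,
  and \<open>y q\<close> collects the coefficients at \<open>q\<close>. The expansion then holds for
  unit vectors and extends linearly to real vectors. The index set stays abstract, so its
  cardinality never has to be compared with \<open>d\<close>.\<close>

lemma int_basis_dual:
  fixes u :: "'q \<Rightarrow> real vec"
  assumes fin: "finite J" and uZ: "\<forall>q\<in>J. u q \<in> int_lattice d"
    and ex: "\<forall>z\<in>int_lattice d. \<exists>c :: 'q \<Rightarrow> int. z = vsum d (\<lambda>q. of_int (c q) \<cdot>\<^sub>v u q) J"
    and indep: "\<forall>c :: 'q \<Rightarrow> int. vsum d (\<lambda>q. of_int (c q) \<cdot>\<^sub>v u q) J = 0\<^sub>v d \<longrightarrow> (\<forall>q\<in>J. c q = 0)"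
  shows "\<exists>y. (\<forall>q. y q \<in> int_lattice d) \<and>
    (\<forall>x\<in>carrier_vec d. vsum d (\<lambda>q. (y q \<bullet> x) \<cdot>\<^sub>v u q) J = x) \<and>
    (\<forall>p\<in>J. \<forall>q\<in>J. y p \<bullet> u q = (if p = q then 1 else 0))"
proof -
  have uc: "u q \<in> carrier_vec d" if "q \<in> J" for q using uZ that by (blast intro: int_lattice_carrier)
  have "\<forall>p. \<exists>c :: 'q \<Rightarrow> int. unit_vec d p = vsum d (\<lambda>q. of_int (c q) \<cdot>\<^sub>v u q) J"
    using ex unit_vec_int_lattice by blast
  from choice[OF this] obtain C :: "nat \<Rightarrow> 'q \<Rightarrow> int"
    where C: "\<And>p. unit_vec d p = vsum d (\<lambda>q. of_int (C p q) \<cdot>\<^sub>v u q) J" by blast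
  define y where "y q = vec d (\<lambda>p. real_of_int (C p q))" for q
  have yZ: "y q \<in> int_lattice d" for q by (auto simp: y_def int_lattice_def)
  have exp: "vsum d (\<lambda>q. (y q \<bullet> x) \<cdot>\<^sub>v u q) J = x" if x: "x \<in> carrier_vec d" for x
  proof -
    have cl: "(\<lambda>q. (y q \<bullet> x) \<cdot>\<^sub>v u q) \<in> J \<rightarrow> carrier_vec d" using uc by auto
    show ?thesis
    proof (rule eq_vecI)
      fix l assume "l < dim_vec x"
      then have l: "l < d" using x by auto
      have e: "(\<Sum>q\<in>J. of_int (C p q) * u q $ l) = (if l = p then 1 else 0)" if "p < d" for p
        using arg_cong[OF C[of p], of "\<lambda>v. v $ l"] l that uc fin
        by (subst (asm) index_finsum_vec) (auto simp: unit_vec_def carrier_vecD[OF uc])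
      have "vsum d (\<lambda>q. (y q \<bullet> x) \<cdot>\<^sub>v u q) J $ l = (\<Sum>q\<in>J. (y q \<bullet> x) * u q $ l)"
        using l cl fin uc by (subst index_finsum_vec) (auto simp: carrier_vecD[OF uc] intro!: sum.cong)
      also have "\<dots> = (\<Sum>q\<in>J. \<Sum>p<d. x $ p * (of_int (C p q) * u q $ l))"
        using x by (intro sum.cong)
          (auto simp: y_def scalar_prod_def sum_distrib_left sum_distrib_right lessThan_atLeast0 mult_ac)
      also have "\<dots> = (\<Sum>p<d. x $ p * (\<Sum>q\<in>J. of_int (C p q) * u q $ l))"
        by (subst sum.swap) (simp add: sum_distrib_left)
      also have "\<dots> = (\<Sum>p<d. if l = p then x $ p else 0)"
        by (intro sum.cong) (auto simp: e)
      finally show "vsum d (\<lambda>q. (y q \<bullet> x) \<cdot>\<^sub>v u q) J $ l = x $ l" using l by simp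
    qed (use x vsum_closed[OF cl] in auto)
  qed
  have dual: "y p \<bullet> u q = (if p = q then 1 else 0)" if p: "p \<in> J" and q: "q \<in> J" for p q
  proof -
    \<comment> \<open>These are the differences between two expansions of \<open>u q\<close>: the
      dual one and the trivial one. Independence is known for integer coefficients only, hence the
      floor of a pairing that is already an integer.\<close>
    define c where "c p = \<lfloor>y p \<bullet> u q\<rfloor> - (if p = q then 1 else 0)" for p
    have yc: "y p \<bullet> u q = of_int \<lfloor>y p \<bullet> u q\<rfloor>" for p
      using scalar_prod_Ints[OF yZ[of p] uZ[rule_format, OF q]] by simp
    let ?f = "\<lambda>p. (y p \<bullet> u q) \<cdot>\<^sub>v u p" and ?g = "\<lambda>p. of_int (if p = q then 1 else 0) \<cdot>\<^sub>v u p"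
    have cl: "?f \<in> J \<rightarrow> carrier_vec d" "?g \<in> J \<rightarrow> carrier_vec d"
        "(\<lambda>p. of_int (c p) \<cdot>\<^sub>v u p) \<in> J \<rightarrow> carrier_vec d" using uc by auto
    have eq: "vsum d ?f J = vsum d ?g J"
      using exp[OF uc[OF q]] vsum_single[OF fin q uc] by simp
    have "vsum d (\<lambda>p. of_int (c p) \<cdot>\<^sub>v u p) J = 0\<^sub>v d"
    proof (rule eq_vecI)
      fix l assume "l < dim_vec (0\<^sub>v d)"
      then have l: "l < d" by simp
      have "vsum d (\<lambda>p. of_int (c p) \<cdot>\<^sub>v u p) J $ l = (\<Sum>p\<in>J. ?f p $ l - ?g p $ l)"
        using l fin cl(3) uc
        by (subst index_finsum_vec)
          (auto simp: c_def carrier_vecD[OF uc] yc[symmetric] algebra_simps intro!: sum.cong)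
      also have "\<dots> = vsum d ?f J $ l - vsum d ?g J $ l"
        using l fin cl(1,2) by (simp only: index_finsum_vec sum_subtractf)
      finally show "vsum d (\<lambda>p. of_int (c p) \<cdot>\<^sub>v u p) J $ l = 0\<^sub>v d $ l" using eq l by simp
    qed (use vsum_closed[OF cl(3)] in auto)
    from indep[rule_format, OF this p] show ?thesis using yc[of p] unfolding c_def by auto
  qed
  show ?thesis using yZ exp dual by blast
qed

text \<open>A dual form is 1 on its own basis ray, 0 on the other basis rays, and at most 0 on each
  extra ray, being minus a sum of nonnegative values there. Its positive part therefore sees a
  single ray. This is all that is later extracted from a given direct sum of Bergman fans.\<close>

lemma bergman_direct_sum_dual_basis:
  assumes "bergman_direct_sum d G"
  shows "\<exists>(J :: (nat \<times> nat) set) u y. finite J \<and> J \<noteq> {} \<and>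
    (\<forall>q\<in>J. u q \<in> rays G) \<and> (\<forall>q\<in>J. u q \<in> int_lattice d) \<and> (\<forall>q. y q \<in> int_lattice d) \<and>
    (\<forall>x\<in>carrier_vec d. vsum d (\<lambda>q. (y q \<bullet> x) \<cdot>\<^sub>v u q) J = x) \<and>
    (\<forall>q\<in>J. intersection_number (\<lambda>v. max 0 (y q \<bullet> v)) G = 1)"
proof -
  obtain s N B where s: "s \<ge> 1" and ds: "lattice_direct_sum d s N"
    and B: "\<forall>i \<in> {1..s}. bergman_fan d (N i) (B i)"
    and G: "rays G = (\<Union>i \<in> {1..s}. rays (B i))"
      "\<forall>v \<in> rays G. weight G v = (\<Sum>i \<in> {i \<in> {1..s}. v \<in> rays (B i)}. weight (B i) v)"
    using assms unfolding bergman_direct_sum_def by blast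
  let ?P = "\<lambda>i k u. k \<ge> 1 \<and> lattice_basis d (N i) k u \<and> u 0 = - vsum d u {1..k} \<and>
     rays (B i) = u ` {0..k} \<and> (\<forall>v \<in> rays (B i). weight (B i) v = 1)"
  have "\<forall>i\<in>{1..s}. \<exists>q. ?P i (fst q) (snd q)"
    using B unfolding bergman_fan_def by auto
  from bchoice[OF this] obtain Q where Q: "\<forall>i\<in>{1..s}. ?P i (fst (Q i)) (snd (Q i))" ..
  define k U where "k i = fst (Q i)" and "U i = snd (Q i)" for i
  have kU: "k i \<ge> 1" "lattice_basis d (N i) (k i) (U i)" "U i 0 = - vsum d (U i) {1..k i}"
     "rays (B i) = U i ` {0..k i}" "\<forall>v \<in> rays (B i). weight (B i) v = 1" if "i \<in> {1..s}" for i
    using Q that unfolding k_def U_def by blast+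
  define J where "J = (SIGMA i:{1..s}. {1..k i})"
  define u where "u = (\<lambda>(i, j). U i j)"
  have "\<forall>i\<in>{1..s}. lattice_basis d (N i) (k i) (U i)" using kU(2) by blast
  note lds = lattice_direct_sum_basis[OF ds this, folded J_def u_def]
  have fin: "finite J" by (simp add: J_def)
  obtain y where y: "\<And>q. y q \<in> int_lattice d"
    "\<And>x. x \<in> carrier_vec d \<Longrightarrow> vsum d (\<lambda>q. (y q \<bullet> x) \<cdot>\<^sub>v u q) J = x"
    "\<And>p q. p \<in> J \<Longrightarrow> q \<in> J \<Longrightarrow> y p \<bullet> u q = (if p = q then 1 else 0)"
    using int_basis_dual[OF fin lds] by blast
  \<comment> \<open>There is at least one summand and each has rank at least one; the resulting
    index is what later yields some regular form.\<close>
  have "(1, 1) \<in> J" using s kU(1)[of 1] by (auto simp: J_def)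
  then have "J \<noteq> {}" by blast
  have uG: "u q \<in> rays G" if "q \<in> J" for q
  proof -
    obtain i j where ij: "q = (i, j)" "i \<in> {1..s}" "j \<in> {1..k i}"
      using \<open>q \<in> J\<close> unfolding J_def by blast
    then have "u q \<in> rays (B i)" by (simp add: kU(4)[OF ij(2)] u_def)
    then show ?thesis using ij(2) unfolding G(1) by blast
  qed
  have U0: "y q \<bullet> U i 0 \<le> 0" if q: "q \<in> J" and i: "i \<in> {1..s}" for q i
  proof -
    have uJ: "U i j \<in> carrier_vec d" "y q \<bullet> U i j \<ge> 0" if "j \<in> {1..k i}" for j
    proof -
      have ij: "(i, j) \<in> J" using i that by (simp add: J_def)
      show "U i j \<in> carrier_vec d" "y q \<bullet> U i j \<ge> 0"
        using lds(1)[rule_format, OF ij] y(3)[OF q ij] by (auto simp: u_def dest: int_lattice_carrier)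
    qed
    have cl: "vsum d (U i) {1..k i} \<in> carrier_vec d" using uJ(1) by (intro vsum_closed) auto
    have "y q \<bullet> U i 0 = - (y q \<bullet> vsum d (U i) {1..k i})"
      using cl int_lattice_carrier[OF y(1)[of q]] by (simp add: kU(3)[OF i])
    also have "\<dots> = - (\<Sum>j\<in>{1..k i}. y q \<bullet> U i j)"
      using uJ(1) int_lattice_carrier[OF y(1)[of q]] by (subst scalar_prod_vsum) auto
    also have "\<dots> \<le> 0" unfolding neg_le_0_iff_le by (rule sum_nonneg) (rule uJ(2))
    finally show ?thesis .
  qed
  have pos: "U i j = u q \<and> i = fst q" if q: "q \<in> J" and i: "i \<in> {1..s}" "j \<in> {0..k i}" and p: "y q \<bullet> U i j > 0" for q i j
  proof -
    have "j \<noteq> 0" using U0[OF q i(1)] p by (intro notI) auto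
    then have ij: "(i, j) \<in> J" using i by (simp add: J_def)
    then have "q = (i, j)" using y(3)[OF q ij] p by (auto simp: u_def split: if_splits)
    then show ?thesis by (simp add: u_def)
  qed
  have "intersection_number (\<lambda>v. max 0 (y q \<bullet> v)) G = 1" if q: "q \<in> J" for q
  proof -
    have yq: "y q \<bullet> u q = 1" using y(3)[OF q q] by simp
    have val: "max 0 (y q \<bullet> v) = (if v = u q then 1 else 0)" if "v \<in> rays G" for v
    proof -
      obtain i j where "i \<in> {1..s}" "j \<in> {0..k i}" "v = U i j"
        using \<open>v \<in> rays G\<close> unfolding G(1) by (auto simp: kU(4))
      then show ?thesis using pos[OF q, of i j] yq by (cases "y q \<bullet> v > 0") auto
    qed
    \<comment> \<open>The weight of a ray adds up over all summands that contain it. Positivity of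
      the dual form on \<open>u q\<close> leaves only the summand of \<open>q\<close>, so the total
      is 1.\<close>
    have "{i \<in> {1..s}. u q \<in> rays (B i)} = {fst q}"
    proof (intro equalityI subsetI)
      fix i assume "i \<in> {i \<in> {1..s}. u q \<in> rays (B i)}"
      then obtain j where "i \<in> {1..s}" "j \<in> {0..k i}" "u q = U i j" by (auto simp: kU(4))
      then show "i \<in> {fst q}" using pos[OF q, of i j] yq by auto
    next
      fix i assume "i \<in> {fst q}"
      then show "i \<in> {i \<in> {1..s}. u q \<in> rays (B i)}"
        using q by (auto simp: J_def u_def kU(4))
    qed
    moreover have "fst q \<in> {1..s}" using q by (auto simp: J_def)
    moreover from calculation have "u q \<in> rays (B (fst q))" by blast
    ultimately have w: "weight G (u q) = 1"
      using G(2) uG[OF q] kU(5)[of "fst q"] by simp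
    have "finite (rays G)" unfolding G(1) by (auto simp: kU(4))
    then show ?thesis
      unfolding intersection_number_def using val w uG[OF q]
      by (simp add: if_distrib[where f = "times _"] cong: if_cong)
  qed
  then have "\<forall>q\<in>J. intersection_number (\<lambda>v. max 0 (y q \<bullet> v)) G = 1" by blast
  moreover have "\<forall>q\<in>J. u q \<in> rays G" using uG by blast
  moreover have "\<forall>q. y q \<in> int_lattice d" using y(1) by blast
  moreover have "\<forall>x\<in>carrier_vec d. vsum d (\<lambda>q. (y q \<bullet> x) \<cdot>\<^sub>v u q) J = x" using y(2) by blast
  ultimately show ?thesis using fin \<open>J \<noteq> {}\<close> lds(1) by (intro exI[of _ J] exI[of _ u] exI[of _ y] conjI)
qed

section \<open>Direct sums of Bergman fans from partitions\<close>

text \<open>Its negative is the extra generator \<open>u 0\<close> of the Bergman fan on the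
  coordinates \<open>C\<close>.\<close>

definition indicator_vec :: "nat \<Rightarrow> nat set \<Rightarrow> real vec" where
  "indicator_vec d C = vec d (\<lambda>i. if i \<in> C then 1 else 0)"

lemma vsum_unit_vec_bij:
  fixes c :: "nat \<Rightarrow> real"
  assumes f: "bij_betw f {1..k} C" and "C \<subseteq> {..<d}"
  shows "vsum d (\<lambda>j. c j \<cdot>\<^sub>v unit_vec d (f j)) {1..k} =
    vec d (\<lambda>l. if l \<in> C then c (inv_into {1..k} f l) else 0)"
proof (rule eq_vecI)
  let ?f = "\<lambda>j. c j \<cdot>\<^sub>v unit_vec d (f j)"
  have cl: "?f \<in> {1..k} \<rightarrow> carrier_vec d" by auto
  show "dim_vec (vsum d ?f {1..k}) = dim_vec (vec d (\<lambda>l. if l \<in> C then c (inv_into {1..k} f l) else 0))"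
    using vsum_closed[OF cl] by simp
  have fin: "finite C" using assms(2) finite_subset by blast
  fix l assume "l < dim_vec (vec d (\<lambda>l. if l \<in> C then c (inv_into {1..k} f l) else 0))"
  then have l: "l < d" by simp
  have "vsum d ?f {1..k} $ l = (\<Sum>j\<in>{1..k}. c j * (if l = f j then 1 else 0))"
    using l by (subst index_finsum_vec[OF _ _ cl]) (auto simp: unit_vec_def)
  also have "\<dots> = (\<Sum>j\<in>{1..k}. c (inv_into {1..k} f (f j)) * (if l = f j then 1 else 0))"
    using f by (intro sum.cong) (auto simp: bij_betw_def)
  also have "\<dots> = (\<Sum>i\<in>C. c (inv_into {1..k} f i) * (if l = i then 1 else 0))"
    by (rule sum.reindex_bij_betw[OF f])
  also have "\<dots> = vec d (\<lambda>l. if l \<in> C then c (inv_into {1..k} f l) else 0) $ l"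
    using l fin by (simp add: if_distrib[where f = "times _"] cong: if_cong)
  finally show "vsum d ?f {1..k} $ l = \<dots>" .
qed

text \<open>The unit vectors of \<open>C\<close>, enumerated by \<open>f\<close> from 1 so that
  index 0 is free for the extra ray, are the basis. The entries of a combination are its
  coefficients, which settles generation, independence and the formula for \<open>u 0\<close> at
  once.\<close>

lemma block_bergman_fan:
  assumes C: "C \<subseteq> {..<d}" "C \<noteq> {}"
  shows "bergman_fan d {z \<in> int_lattice d. \<forall>i<d. i \<notin> C \<longrightarrow> z $ i = 0}
    \<lparr>rays = insert (- indicator_vec d C) (unit_vec d ` C), weight = \<lambda>_. 1\<rparr>"
    (is "bergman_fan d ?N ?B")
proof -
  define k where "k = card C"
  have fin: "finite C" using C(1) finite_subset by blast
  have k: "k \<ge> 1" using fin C(2) by (simp add: k_def Suc_le_eq card_gt_0_iff)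
  obtain f where f: "bij_betw f {1..k} C" using ex_bij_betw_nat_finite_1[OF fin] by (auto simp: k_def)
  define g where "g = inv_into {1..k} f"
  have g: "g i \<in> {1..k}" "f (g i) = i" if "i \<in> C" for i
    using f that unfolding g_def bij_betw_def by (auto intro: inv_into_into f_inv_into_f)
  have gf: "g (f j) = j" "f j \<in> C" if "j \<in> {1..k}" for j
    using f that unfolding g_def bij_betw_def by auto
  define u where "u j = (if j = 0 then - indicator_vec d C else unit_vec d (f j))" for j
  have vs: "vsum d (\<lambda>j. c j \<cdot>\<^sub>v u j) {1..k} = vec d (\<lambda>l. if l \<in> C then c (g l) else 0)"
    for c :: "nat \<Rightarrow> real"
  proof -
    have "vsum d (\<lambda>j. c j \<cdot>\<^sub>v u j) {1..k} = vsum d (\<lambda>j. c j \<cdot>\<^sub>v unit_vec d (f j)) {1..k}"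
      by (rule vsum_cong) (auto simp: u_def)
    then show ?thesis by (simp only: vsum_unit_vec_bij[OF f C(1)] g_def)
  qed
  have "lattice_basis d ?N k u"
    unfolding lattice_basis_def
  proof (intro conjI allI impI)
    show "\<forall>i\<in>{1..k}. u i \<in> carrier_vec d" by (auto simp: u_def)
    show "?N = {vsum d (\<lambda>i. of_int (c i) \<cdot>\<^sub>v u i) {1..k} | c. True}"
    proof (intro equalityI subsetI)
      fix z assume z: "z \<in> ?N"
      have "z = vsum d (\<lambda>i. of_int \<lfloor>z $ f i\<rfloor> \<cdot>\<^sub>v u i) {1..k}"
        unfolding vs using z C(1) by (intro eq_vecI) (auto simp: int_lattice_def g)
      then show "z \<in> {vsum d (\<lambda>i. of_int (c i) \<cdot>\<^sub>v u i) {1..k} | c. True}"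
        by (intro CollectI exI[of _ "\<lambda>i. \<lfloor>z $ f i\<rfloor>"] conjI TrueI)
    next
      fix z assume "z \<in> {vsum d (\<lambda>i. of_int (c i) \<cdot>\<^sub>v u i) {1..k} | c. True}"
      then obtain c :: "nat \<Rightarrow> int" where "z = vsum d (\<lambda>i. of_int (c i) \<cdot>\<^sub>v u i) {1..k}" by blast
      then show "z \<in> ?N" unfolding vs by (auto simp: int_lattice_def)
    qed
    fix c :: "nat \<Rightarrow> int"
    assume c: "vsum d (\<lambda>i. of_int (c i) \<cdot>\<^sub>v u i) {1..k} = 0\<^sub>v d"
    show "\<forall>i\<in>{1..k}. c i = 0"
    proof
      fix i assume i: "i \<in> {1..k}"
      have "f i < d" using gf(2)[OF i] C(1) by auto
      then show "c i = 0"
        using arg_cong[OF c[unfolded vs], of "\<lambda>v. v $ f i"] gf[OF i] by simp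
    qed
  qed
  moreover have "u 0 = - vsum d u {1..k}"
  proof -
    have "vsum d u {1..k} = vsum d (\<lambda>j. 1 \<cdot>\<^sub>v u j) {1..k}" by simp
    also have "\<dots> = indicator_vec d C" unfolding vs indicator_vec_def ..
    finally show ?thesis by (simp add: u_def)
  qed
  moreover have "rays ?B = u ` {0..k}"
  proof -
    have "{0..k} = insert 0 {1..k}" by auto
    moreover have "u ` {1..k} = unit_vec d ` f ` {1..k}" by (auto simp: u_def)
    moreover have "f ` {1..k} = C" using f by (simp add: bij_betw_def)
    ultimately have "u ` {0..k} = insert (u 0) (unit_vec d ` C)" by (simp only: image_insert)
    then show ?thesis by (simp add: u_def)
  qed
  ultimately show ?thesis unfolding bergman_fan_def using k by auto
qed

text \<open>Each coordinate \<open>i\<close> lies in exactly one block, the one numbered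
  \<open>A i\<close>. A lattice vector hence splits uniquely into its restrictions to the
  blocks.\<close>

lemma partition_bergman_direct_sum:
  assumes P: "P \<noteq> {}" "\<Union>P = {..<d}" "\<And>C. C \<in> P \<Longrightarrow> C \<noteq> {}"
    and disj: "\<And>C C'. C \<in> P \<Longrightarrow> C' \<in> P \<Longrightarrow> C \<inter> C' \<noteq> {} \<Longrightarrow> C = C'"
    and G: "rays G = (\<Union>C\<in>P. insert (- indicator_vec d C) (unit_vec d ` C))"
      "\<And>v. v \<in> rays G \<Longrightarrow> weight G v = 1"
  shows "bergman_direct_sum d G"
proof -
  define s where "s = card P"
  have Pd: "C \<subseteq> {..<d}" if "C \<in> P" for C using that P(2) by blast
  have fin: "finite P" using P(2) by (metis finite_UnionD finite_lessThan)
  have s: "s \<ge> 1" using fin P(1) by (simp add: s_def Suc_le_eq card_gt_0_iff)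
  obtain h where h: "bij_betw h {1..s} P" using ex_bij_betw_nat_finite_1[OF fin] by (auto simp: s_def)
  have hP: "h a \<in> P" if "a \<in> {1..s}" for a using h that by (auto simp: bij_betw_def)
  have "\<forall>i. \<exists>a. i < d \<longrightarrow> a \<in> {1..s} \<and> i \<in> h a"
  proof
    fix i
    show "\<exists>a. i < d \<longrightarrow> a \<in> {1..s} \<and> i \<in> h a"
    proof (cases "i < d")
      case True
      then obtain C where "C \<in> P" "i \<in> C" using P(2) by blast
      moreover then obtain a where "a \<in> {1..s}" "h a = C" using h by (auto simp: bij_betw_def)
      ultimately show ?thesis by blast
    qed simp
  qed
  from choice[OF this] obtain A where A0: "\<forall>i<d. A i \<in> {1..s} \<and> i \<in> h (A i)" by blast
  have A: "i \<in> h a \<longleftrightarrow> a = A i" if "i < d" "a \<in> {1..s}" for i a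
  proof
    assume i: "i \<in> h a"
    have "h a = h (A i)" using disj[OF hP hP] that i A0 by blast
    then show "a = A i" using h that A0 by (auto simp: bij_betw_def dest: inj_onD)
  qed (use A0 that in auto)
  define N where "N a = {z \<in> int_lattice d. \<forall>i<d. i \<notin> h a \<longrightarrow> z $ i = 0}" for a
  define B where "B a = \<lparr>rays = insert (- indicator_vec d (h a)) (unit_vec d ` h a), weight = \<lambda>_. 1\<rparr>" for a
  have Nc: "x a \<in> carrier_vec d" if "x \<in> Pi\<^sub>E {1..s} N" "a \<in> {1..s}" for x a
    using that by (auto simp: N_def PiE_def Pi_def int_lattice_def)
  have sumN: "vsum d x {1..s} $ i = x (A i) $ i" if x: "x \<in> Pi\<^sub>E {1..s} N" and i: "i < d" for x i
  proof -
    have "vsum d x {1..s} $ i = (\<Sum>a\<in>{1..s}. x a $ i)"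
      using Nc[OF x] i by (intro index_finsum_vec) auto
    also have "\<dots> = (\<Sum>a\<in>{1..s}. if a = A i then x a $ i else 0)"
    proof (intro sum.cong refl)
      fix a assume a: "a \<in> {1..s}"
      then have "x a \<in> N a" using x by auto
      then show "x a $ i = (if a = A i then x a $ i else 0)"
        using A[OF i a] i unfolding N_def by auto
    qed
    also have "\<dots> = x (A i) $ i" using A0 i by simp
    finally show ?thesis .
  qed
  have "lattice_direct_sum d s N"
    unfolding lattice_direct_sum_def
  proof (intro conjI ballI)
    show "N i \<subseteq> int_lattice d" for i by (auto simp: N_def)
    fix z assume z: "z \<in> int_lattice d"
    let ?x = "\<lambda>a\<in>{1..s}. vec d (\<lambda>i. if a = A i then z $ i else 0)"
    show "\<exists>!x. x \<in> Pi\<^sub>E {1..s} N \<and> vsum d x {1..s} = z"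
    proof (intro ex1I[of _ ?x] conjI)
      show x: "?x \<in> Pi\<^sub>E {1..s} N"
      proof (rule restrict_PiE_iff[THEN iffD2], rule ballI)
        fix a assume "a \<in> {1..s}"
        then show "vec d (\<lambda>i. if a = A i then z $ i else 0) \<in> N a"
          using z A by (auto simp: N_def int_lattice_def)
      qed
      show "vsum d ?x {1..s} = z"
      proof (rule eq_vecI)
        fix i assume "i < dim_vec z"
        then have i: "i < d" using z by (auto simp: int_lattice_def)
        then have "A i \<in> {1..s}" using A0 by blast
        then show "vsum d ?x {1..s} $ i = z $ i" unfolding sumN[OF x i] using i by simp
      next
        have "vsum d ?x {1..s} \<in> carrier_vec d" by (rule vsum_closed) auto
        then show "dim_vec (vsum d ?x {1..s}) = dim_vec z" using z by (auto simp: int_lattice_def)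
      qed
    next
      fix x assume x: "x \<in> Pi\<^sub>E {1..s} N \<and> vsum d x {1..s} = z"
      show "x = ?x"
      proof
        fix a
        show "x a = ?x a"
        proof (cases "a \<in> {1..s}")
          case True
          then have xa: "x a \<in> N a" using x by auto
          have "x a = vec d (\<lambda>i. if a = A i then z $ i else 0)"
          proof (rule eq_vecI)
            fix i assume "i < dim_vec (vec d (\<lambda>i. if a = A i then z $ i else 0))"
            then have i: "i < d" by simp
            show "x a $ i = vec d (\<lambda>i. if a = A i then z $ i else 0) $ i"
              using xa i A[OF i True] sumN[OF conjunct1[OF x] i] x by (auto simp: N_def)
          qed (use xa in \<open>auto simp: N_def int_lattice_def\<close>)
          then show ?thesis using True by simp
        next
          case False
          then show ?thesis using x by (auto simp: PiE_def extensional_def)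
        qed
      qed
    qed
  qed
  moreover have "\<forall>i\<in>{1..s}. bergman_fan d (N i) (B i)"
    unfolding N_def B_def using block_bergman_fan[OF Pd P(3)] hP by blast
  moreover have rG: "rays G = (\<Union>i\<in>{1..s}. rays (B i))"
  proof -
    have "h ` {1..s} = P" using h by (simp add: bij_betw_def)
    then show ?thesis unfolding G(1) B_def by auto
  qed
  moreover have "\<forall>v\<in>rays G. weight G v = (\<Sum>i\<in>{i\<in>{1..s}. v \<in> rays (B i)}. weight (B i) v)"
  proof
    fix v assume v: "v \<in> rays G"
    then obtain a where a: "a \<in> {1..s}" "v \<in> rays (B a)" unfolding rG by blast
    \<comment> \<open>A nonzero entry of a ray lies in the block the ray comes from. One such entry
      therefore identifies the block, and no ray is counted in two summands.\<close>
    have supp: "i \<in> h b" if "v \<in> rays (B b)" "i < d" "v $ i \<noteq> 0" for b i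
      using that by (auto simp: B_def indicator_vec_def unit_vec_def split: if_splits)
    obtain i where i: "i < d" "i \<in> h a" "v $ i \<noteq> 0"
    proof -
      obtain j where j: "j \<in> h a" using P(3)[OF hP[OF a(1)]] by blast
      have hd: "h a \<subseteq> {..<d}" using Pd hP a(1) by blast
      from a(2) consider "v = - indicator_vec d (h a)" | l where "l \<in> h a" "v = unit_vec d l"
        unfolding B_def by auto
      then show thesis
      proof cases
        case 1
        then show thesis using that[of j] j hd by (auto simp: indicator_vec_def)
      next
        case 2
        then show thesis using that[of l] hd by (auto simp: unit_vec_def)
      qed
    qed
    have "b = a" if b: "b \<in> {1..s}" "v \<in> rays (B b)" for b
      using supp[OF b(2) i(1,3)] i A[OF i(1) b(1)] A[OF i(1) a(1)] by auto
    then have "{i\<in>{1..s}. v \<in> rays (B i)} = {a}" using a by blast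
    then show "weight G v = (\<Sum>i\<in>{i\<in>{1..s}. v \<in> rays (B i)}. weight (B i) v)"
      using G(2)[OF v] by (simp add: B_def)
  qed
  ultimately show ?thesis unfolding bergman_direct_sum_def using s by blast
qed

section \<open>Push-forwards whose image vectors are zero or primitive\<close>

lemma primitive_vec_unit_entry:
  assumes "u \<in> int_lattice r" "i < r" "\<bar>u $ i\<bar> = 1"
  shows "primitive_vec r u"
  unfolding primitive_vec_def
proof (intro conjI ballI allI impI assms)
  show "u \<noteq> 0\<^sub>v r" using assms by auto
  fix w and m :: nat assume w: "w \<in> int_lattice r" "u = of_nat m \<cdot>\<^sub>v w"
  then have "u $ i = real m * w $ i" "w $ i \<in> \<int>" using assms(2) by (auto simp: int_lattice_def)
  then obtain k :: int where k: "u $ i = of_int (int m * k)" by (auto elim!: Ints_cases)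
  have "\<bar>int m * k\<bar> = 1" using assms(3) unfolding k by linarith
  then have "int m * \<bar>k\<bar> = 1" by (simp add: abs_mult)
  then have "int m dvd 1" by (metis dvd_triv_left)
  then show "m = 1" by simp
qed

text \<open>By uniqueness of the primitive decomposition every multiplicity is 1, so the
  push-forward is plain image and summation over fibres.\<close>

lemma push_forward_primitive:
  assumes \<pi>: "\<And>v. v \<in> rays F \<Longrightarrow> \<pi> v = 0\<^sub>v r \<or> primitive_vec r (\<pi> v)"
  shows "rays (push_forward r \<pi> F) = {\<pi> v | v. v \<in> rays F \<and> \<pi> v \<noteq> 0\<^sub>v r}"
    and "u \<in> rays (push_forward r \<pi> F) \<Longrightarrow>
      weight (push_forward r \<pi> F) u = (\<Sum>v\<in>{v\<in>rays F. \<pi> v = u}. weight F v)"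
proof -
  have key: "m = 1 \<and> \<pi> v = u" if h: "v \<in> rays F" "primitive_vec r u" "(m::nat) > 0" "\<pi> v = of_nat m \<cdot>\<^sub>v u" for u v m
  proof -
    obtain i where i: "i < r" "u $ i \<noteq> 0"
      using h(2) unfolding primitive_vec_def int_lattice_def
      by (metis (no_types, lifting) carrier_vecD eq_vecI index_zero_vec mem_Collect_eq)
    then have "\<pi> v $ i \<noteq> 0" using h by (auto simp: primitive_vec_def int_lattice_def)
    then have "\<pi> v \<noteq> 0\<^sub>v r" using i by auto
    then have p: "primitive_vec r (\<pi> v)" using \<pi>[OF h(1)] by blast
    have "of_nat m \<cdot>\<^sub>v u = of_nat 1 \<cdot>\<^sub>v \<pi> v" using h(4) by simp
    from primitive_decomposition_unique[OF h(2) p h(3) _ this] show ?thesis by simp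
  qed
  have one: "\<pi> v = of_nat 1 \<cdot>\<^sub>v \<pi> v" for v by simp
  show r: "rays (push_forward r \<pi> F) = {\<pi> v | v. v \<in> rays F \<and> \<pi> v \<noteq> 0\<^sub>v r}"
  proof (intro equalityI subsetI)
    fix u assume "u \<in> rays (push_forward r \<pi> F)"
    then obtain v and m :: nat where v: "primitive_vec r u" "v \<in> rays F" "m > 0" "\<pi> v = of_nat m \<cdot>\<^sub>v u"
      unfolding push_forward_def by auto
    from key[OF v(2,1,3,4)] show "u \<in> {\<pi> v | v. v \<in> rays F \<and> \<pi> v \<noteq> 0\<^sub>v r}"
      using v(1,2) by (auto simp: primitive_vec_def)
  next
    fix u assume "u \<in> {\<pi> v | v. v \<in> rays F \<and> \<pi> v \<noteq> 0\<^sub>v r}"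
    then obtain v where v: "u = \<pi> v" "v \<in> rays F" "\<pi> v \<noteq> 0\<^sub>v r" by blast
    then have "primitive_vec r u" using \<pi> by blast
    moreover have "\<exists>v\<in>rays F. \<exists>m::nat. 0 < m \<and> \<pi> v = of_nat m \<cdot>\<^sub>v u"
      using v(1,2) by (intro bexI[of _ v] exI[of _ 1]) simp_all
    ultimately show "u \<in> rays (push_forward r \<pi> F)" unfolding push_forward_def by simp
  qed
  show "weight (push_forward r \<pi> F) u = (\<Sum>v\<in>{v\<in>rays F. \<pi> v = u}. weight F v)"
    if u: "u \<in> rays (push_forward r \<pi> F)"
  proof -
    have pu: "primitive_vec r u" using u unfolding push_forward_def by simp
    have "{(v, m). v \<in> rays F \<and> 0 < m \<and> \<pi> v = of_nat m \<cdot>\<^sub>v u} = (\<lambda>v. (v, 1)) ` {v\<in>rays F. \<pi> v = u}"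
    proof (intro equalityI subsetI)
      fix x assume "x \<in> {(v, m). v \<in> rays F \<and> 0 < m \<and> \<pi> v = of_nat m \<cdot>\<^sub>v u}"
      then obtain v m where "x = (v, m)" "v \<in> rays F" "0 < m" "\<pi> v = of_nat m \<cdot>\<^sub>v u" by blast
      with key[OF this(2) pu this(3,4)] show "x \<in> (\<lambda>v. (v, 1)) ` {v\<in>rays F. \<pi> v = u}" by blast
    next
      fix x assume "x \<in> (\<lambda>v. (v, 1 :: nat)) ` {v\<in>rays F. \<pi> v = u}"
      then obtain v where "x = (v, 1)" "v \<in> rays F" "\<pi> v = u" by blast
      then show "x \<in> {(v, m). v \<in> rays F \<and> 0 < m \<and> \<pi> v = of_nat m \<cdot>\<^sub>v u}"
        using one[of v] by simp
    qed
    moreover have "inj_on (\<lambda>v. (v, 1 :: nat)) {v\<in>rays F. \<pi> v = u}" by (auto intro: inj_onI)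
    ultimately show ?thesis unfolding push_forward_def by (simp add: sum.reindex)
  qed
qed

section \<open>Span and dimension of a direct sum of Bergman fans\<close>

lemma bergman_direct_sum_span:
  assumes "bergman_direct_sum d G" "rays G \<subseteq> carrier_vec d"
  shows "fan_span d G = carrier_vec d"
proof -
  interpret V: vec_space "TYPE(real)" d .
  obtain J :: "(nat \<times> nat) set" and u y where J: "finite J" "J \<noteq> {}"
    "\<forall>q\<in>J. u q \<in> rays G" "\<forall>q\<in>J. u q \<in> int_lattice d" "\<forall>q. y q \<in> int_lattice d"
    "\<forall>x\<in>carrier_vec d. vsum d (\<lambda>q. (y q \<bullet> x) \<cdot>\<^sub>v u q) J = x"
    "\<forall>q\<in>J. intersection_number (\<lambda>v. max 0 (y q \<bullet> v)) G = 1"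
    using bergman_direct_sum_dual_basis[OF assms(1)] by (elim exE conjE) (rule that)
  note J = J(1,2) J(3-)[rule_format]
  have sub: "submodule class_ring (fan_span d G) (real_space d)"
    unfolding fan_span_def using assms(2) by (intro V.span_is_submodule)
  have "vsum d f I \<in> fan_span d G" if "finite I" "\<And>q. q \<in> I \<Longrightarrow> f q \<in> fan_span d G" for f and I :: "(nat \<times> nat) set"
    using that
  proof (induct I)
    case empty
    then show ?case using submodule.zero_closed[OF sub] by (simp add: finsum_vec_empty module_vec_simps)
  next
    case (insert i I)
    have c: "f q \<in> carrier_vec d" if "q \<in> insert i I" for q
      using insert(4)[OF that] submodule.subset[OF sub] by (auto simp: module_vec_simps)
    have "f i + vsum d f I \<in> fan_span d G"
      using submodule.m_closed[OF sub, of "f i" "vsum d f I"] insert by (simp add: module_vec_simps)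
    then show ?case using insert c by (subst finsum_vec_insert) auto
  qed
  note cl = this
  have in_span: "u q \<in> fan_span d G" if "q \<in> J" for q
    using J(3)[OF that] V.in_own_span[OF assms(2)] unfolding fan_span_def by blast
  \<comment> \<open>The dual expansion writes an arbitrary real vector as a combination of the rays
    \<open>u q\<close>.\<close>
  have "x \<in> fan_span d G" if x: "x \<in> carrier_vec d" for x
  proof -
    have "c \<cdot>\<^sub>v u q \<in> fan_span d G" if "q \<in> J" for c q
      using submodule.smult_closed[OF sub, of c "u q"] in_span[OF that] by (simp add: module_vec_simps)
    then have "vsum d (\<lambda>q. (y q \<bullet> x) \<cdot>\<^sub>v u q) J \<in> fan_span d G" by (intro cl[OF J(1)])
    then show ?thesis using J(6)[OF x] by simp
  qed
  then show ?thesis using submodule.subset[OF sub] by (auto simp: module_vec_simps)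
qed

lemma bergman_direct_sum_span_dim:
  assumes "bergman_direct_sum d G" "rays G \<subseteq> carrier_vec d"
  shows "fan_span_dim d G = d"
proof -
  interpret V: vec_space "TYPE(real)" d .
  have "real_space d\<lparr>carrier := carrier_vec d\<rparr> = real_space d" by (simp add: module_vec_def)
  then have "fan_span_dim d G = V.dim"
    unfolding fan_span_dim_def bergman_direct_sum_span[OF assms] by (simp only:)
  then show ?thesis using V.dim_is_n by simp
qed

lemma push_forward_rays_carrier: "rays (push_forward r \<pi> F) \<subseteq> carrier_vec r"
  by (auto simp: push_forward_def primitive_vec_def int_lattice_def)

section \<open>Regular forms and the universal map\<close>

locale spanning_fan =
  fixes n :: nat and F :: fan
  assumes trop: "tropical_fan n F" and span: "fan_span n F = carrier_vec n"
begin

lemmas fan_rays = tropical_fan_rays[OF trop]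

lemma ray_carrier: "v \<in> rays F \<Longrightarrow> v \<in> carrier_vec n"
  using fan_rays by blast

lemma ray_int: "v \<in> rays F \<Longrightarrow> v \<in> int_lattice n"
  using fan_rays by blast

definition regular_form :: "real vec \<Rightarrow> bool" where
  "regular_form a \<longleftrightarrow> a \<in> int_lattice n \<and> intersection_number (\<lambda>x. max 0 (a \<bullet> x)) F = 1"

text \<open>The difference of two truth values covers \<open>v = w\<close> as well: the form then
  vanishes on all rays. Values at a shared ray cancel in sums, so no case distinction is needed for
  reflexivity or transitivity.\<close>

definition separates :: "real vec \<Rightarrow> real vec \<Rightarrow> real vec \<Rightarrow> bool" where
  "separates a v w \<longleftrightarrow>
     a \<in> int_lattice n \<and> (\<forall>x\<in>rays F. a \<bullet> x = of_bool (x = v) - of_bool (x = w))"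

definition unit_rays :: "real vec set" where
  "unit_rays = {v \<in> rays F. weight F v = 1}"

text \<open>By balancing, a separating form forces only equal weights of the two rays; that the
  common weight is 1 is asked separately.\<close>

definition linked :: "real vec \<Rightarrow> real vec \<Rightarrow> bool" where
  "linked v w \<longleftrightarrow> v \<in> unit_rays \<and> w \<in> unit_rays \<and> (\<exists>a. separates a v w)"

text \<open>A sum of natural numbers equal to 1 has exactly one nonzero term; that term is weight
  times value, so both factors are 1.\<close>

lemma regular_form_positive_part:
  assumes "regular_form a"
  shows "\<exists>v\<in>unit_rays. \<forall>x\<in>rays F. max 0 (a \<bullet> x) = of_bool (x = v)"
proof -
  let ?f = "\<lambda>x. weight F x * nat \<lfloor>max 0 (a \<bullet> x)\<rfloor>"
  have a: "a \<in> int_lattice n" using assms by (simp add: regular_form_def)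
  have fl: "real (nat \<lfloor>max 0 (a \<bullet> x)\<rfloor>) = max 0 (a \<bullet> x)" if "x \<in> rays F" for x
  proof -
    have "max 0 (a \<bullet> x) \<in> \<int>" using scalar_prod_Ints[OF a ray_int[OF that]] by (simp add: max_def)
    then obtain k where k: "max 0 (a \<bullet> x) = of_int k" by (rule Ints_cases)
    have "0 \<le> max 0 (a \<bullet> x)" by simp
    then have "0 \<le> k" unfolding k by simp
    then show ?thesis unfolding k by simp
  qed
  have "real (sum ?f (rays F)) = intersection_number (\<lambda>x. max 0 (a \<bullet> x)) F"
    unfolding intersection_number_def of_nat_sum by (intro sum.cong) (simp_all only: of_nat_mult fl)
  also have "\<dots> = 1" using assms by (simp add: regular_form_def)
  finally have "sum ?f (rays F) = 1" by linarith
  then obtain v where v: "v \<in> rays F" "?f v = 1" "\<forall>x\<in>rays F. v \<noteq> x \<longrightarrow> ?f x = 0"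
    using sum_eq_1_iff[OF fan_rays(1), of ?f] by blast
  have "v \<in> unit_rays" using v(1,2) by (simp add: unit_rays_def)
  moreover have "max 0 (a \<bullet> x) = of_bool (x = v)" if x: "x \<in> rays F" for x
  proof (cases "x = v")
    case True
    then show ?thesis using v(2) fl[OF v(1)] by simp
  next
    case False
    \<comment> \<open>Weights are positive, so a vanishing term means a vanishing value.\<close>
    then have "nat \<lfloor>max 0 (a \<bullet> x)\<rfloor> = 0" using v(3) x fan_rays(4)[OF x] by auto
    then have "max 0 (a \<bullet> x) = 0" using fl[OF x] by simp
    then show ?thesis using False by simp
  qed
  ultimately show ?thesis by blast
qed

text \<open>Since max(0, -t) = max(0, t) - t, the two intersection numbers differ by the weighted
  sum of the values of \<open>a\<close>, which balancing makes zero.\<close>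

lemma regular_form_uminus:
  assumes "regular_form a"
  shows "regular_form (- a)"
proof -
  have a: "a \<in> int_lattice n" "intersection_number (\<lambda>x. max 0 (a \<bullet> x)) F = 1"
    using assms by (simp_all add: regular_form_def)
  have ac: "a \<in> carrier_vec n" by (rule int_lattice_carrier[OF a(1)])
  have "intersection_number (\<lambda>x. max 0 (- a \<bullet> x)) F
      = (\<Sum>v\<in>rays F. weight F v * max 0 (a \<bullet> v) - weight F v * (a \<bullet> v))"
    unfolding intersection_number_def
  proof (intro sum.cong refl)
    fix v assume "v \<in> rays F"
    then have "- a \<bullet> v = - (a \<bullet> v)" using uminus_scalar_prod[OF ac ray_carrier] by simp
    then show "real (weight F v) * max 0 (- a \<bullet> v) = weight F v * max 0 (a \<bullet> v) - weight F v * (a \<bullet> v)"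
      by (simp add: max_def algebra_simps)
  qed
  also have "\<dots> = 1"
    using a(2) tropical_fan_balance[OF trop ac] by (simp add: sum_subtractf intersection_number_def)
  finally show ?thesis using a(1) int_lattice_closed(2) by (simp add: regular_form_def)
qed

text \<open>Apply the statement on positive parts to \<open>a\<close> and to \<open>- a\<close>, and
  use t = max(0, t) - max(0, -t). The two rays differ because \<open>a\<close> takes the value 1,
  not 0, on the first.\<close>

lemma regular_form_separates:
  assumes "regular_form a"
  obtains v w where "v \<noteq> w" "linked v w" "separates a v w"
proof -
  have a: "a \<in> int_lattice n" using assms by (simp add: regular_form_def)
  obtain v where v: "v \<in> unit_rays" "\<And>x. x \<in> rays F \<Longrightarrow> max 0 (a \<bullet> x) = of_bool (x = v)"
    using regular_form_positive_part[OF assms] by metis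
  obtain w where w: "w \<in> unit_rays" "\<And>x. x \<in> rays F \<Longrightarrow> max 0 (- a \<bullet> x) = of_bool (x = w)"
    using regular_form_positive_part[OF regular_form_uminus[OF assms]] by metis
  have val: "a \<bullet> x = of_bool (x = v) - of_bool (x = w)" if x: "x \<in> rays F" for x
  proof -
    have "- a \<bullet> x = - (a \<bullet> x)"
      using uminus_scalar_prod[OF int_lattice_carrier[OF a] ray_carrier[OF x]] by simp
    then show ?thesis using v(2)[OF x] w(2)[OF x] by linarith
  qed
  have vR: "v \<in> rays F" using v(1) by (simp add: unit_rays_def)
  have "v \<noteq> w" using val[OF vR] v(2)[OF vR] by auto
  moreover have "separates a v w" using a val by (simp add: separates_def)
  ultimately show thesis using that v(1) w(1) unfolding linked_def by blast
qed

section \<open>The equivalence relation and its representatives\<close>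

lemma linked_refl: "v \<in> unit_rays \<Longrightarrow> linked v v"
  using int_lattice_closed(1)[of n] ray_carrier
  by (auto simp: linked_def separates_def intro!: exI[of _ "0\<^sub>v n"])

lemma linked_sym:
  assumes "linked v w"
  shows "linked w v"
proof -
  obtain a where a: "separates a v w" using assms by (auto simp: linked_def)
  then have aZ: "a \<in> int_lattice n" by (simp add: separates_def)
  have "separates (- a) w v"
    using a int_lattice_closed(2)[OF aZ] uminus_scalar_prod[OF int_lattice_carrier[OF aZ] ray_carrier]
    by (simp add: separates_def flip: uminus_scalar_prod[OF int_lattice_carrier[OF aZ] ray_carrier])
  then show ?thesis using assms by (auto simp: linked_def)
qed

lemma linked_trans:
  assumes "linked u v" "linked v w"
  shows "linked u w"
proof -
  obtain a b where ab: "separates a u v" "separates b v w" using assms by (auto simp: linked_def)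
  then have Z: "a \<in> int_lattice n" "b \<in> int_lattice n" by (simp_all add: separates_def)
  have "separates (a + b) u w"
    using ab int_lattice_closed(3)[OF Z] Z[THEN int_lattice_carrier] ray_carrier
    by (auto simp: separates_def add_scalar_prod_distrib[of _ n])
  then show ?thesis using assms by (auto simp: linked_def)
qed

text \<open>Linked rays have equal predicates \<open>linked v\<close>, so the choice depends only on
  the class.\<close>

definition base :: "real vec \<Rightarrow> real vec" where
  "base v = (SOME w. linked v w)"

lemma linked_base: "v \<in> unit_rays \<Longrightarrow> linked v (base v)"
  unfolding base_def by (rule someI[of _ v]) (rule linked_refl)

lemma base_unit_rays: "v \<in> unit_rays \<Longrightarrow> base v \<in> unit_rays"
  using linked_base unfolding linked_def by blast

lemma base_eq:
  assumes "linked v w"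
  shows "base v = base w"
proof -
  have "linked v = linked w" using assms linked_sym linked_trans by blast
  then show ?thesis by (simp add: base_def)
qed

lemma base_base: "v \<in> unit_rays \<Longrightarrow> base (base v) = base v"
  using base_eq[OF linked_base] by simp

section \<open>Coordinates relative to the base rays\<close>

definition free_rays :: "real vec set" where
  "free_rays = {v \<in> unit_rays. base v \<noteq> v}"

text \<open>A class of m rays contributes m - 1, the dimension spanned by a Bergman fan with m rays;
  a class with one ray contributes nothing.\<close>

definition target_dim :: nat where
  "target_dim = card free_rays"

definition enum_ray :: "nat \<Rightarrow> real vec" where
  "enum_ray = (SOME g. bij_betw g {..<target_dim} free_rays)"

definition base_form :: "real vec \<Rightarrow> real vec" where
  "base_form v = (SOME a. separates a v (base v))"

definition bergman_map :: "real vec \<Rightarrow> real vec" where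
  "bergman_map x = vec target_dim (\<lambda>i. base_form (enum_ray i) \<bullet> x)"

lemma unit_rays_sub: "unit_rays \<subseteq> rays F" and free_rays_sub: "free_rays \<subseteq> unit_rays"
  by (auto simp: unit_rays_def free_rays_def)

lemma enum_ray: "bij_betw enum_ray {..<target_dim} free_rays"
proof -
  have "finite free_rays"
    using fan_rays(1) unit_rays_sub free_rays_sub by (meson finite_subset)
  from ex_bij_betw_nat_finite[OF this] have "\<exists>g. bij_betw g {..<target_dim} free_rays"
    by (simp add: target_dim_def lessThan_atLeast0)
  then show ?thesis unfolding enum_ray_def by (rule someI_ex)
qed

lemma enum_ray_free: "i < target_dim \<Longrightarrow> enum_ray i \<in> free_rays"
  using enum_ray by (auto simp: bij_betw_def)

lemma enum_ray_unit: "i < target_dim \<Longrightarrow> enum_ray i \<in> unit_rays"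
  using enum_ray_free free_rays_sub by blast

lemma enum_ray_inj: "i < target_dim \<Longrightarrow> j < target_dim \<Longrightarrow> enum_ray i = enum_ray j \<longleftrightarrow> i = j"
  using enum_ray by (auto simp: bij_betw_def dest: inj_onD)

lemma separates_base_form:
  assumes "v \<in> unit_rays"
  shows "separates (base_form v) v (base v)"
proof -
  have "\<exists>a. separates a v (base v)" using linked_base[OF assms] by (simp add: linked_def)
  then show ?thesis unfolding base_form_def by (rule someI_ex)
qed

lemma base_form_int: "v \<in> unit_rays \<Longrightarrow> base_form v \<in> int_lattice n"
  using separates_base_form by (simp add: separates_def)

lemma base_form_carrier: "v \<in> unit_rays \<Longrightarrow> base_form v \<in> carrier_vec n"
  using base_form_int int_lattice_carrier by blast

lemma bergman_map_int_linear: "int_linear_map n target_dim bergman_map"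
proof -
  have 1: "base_form (enum_ray i) \<in> carrier_vec n" "base_form (enum_ray i) \<in> int_lattice n"
    if "i < target_dim" for i
    using base_form_carrier base_form_int enum_ray_unit that by auto
  show ?thesis
    unfolding int_linear_map_iff bergman_map_def
  proof (intro conjI ballI allI)
    fix x y :: "real vec" and c :: real
    assume x: "x \<in> carrier_vec n"
    show "vec target_dim (\<lambda>i. base_form (enum_ray i) \<bullet> (c \<cdot>\<^sub>v x)) =
        c \<cdot>\<^sub>v vec target_dim (\<lambda>i. base_form (enum_ray i) \<bullet> x)"
      using 1 x by (intro eq_vecI) (auto)
    assume y: "y \<in> carrier_vec n"
    show "vec target_dim (\<lambda>i. base_form (enum_ray i) \<bullet> (x + y)) =
        vec target_dim (\<lambda>i. base_form (enum_ray i) \<bullet> x) + vec target_dim (\<lambda>i. base_form (enum_ray i) \<bullet> y)"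
      using 1 x y by (intro eq_vecI) (auto simp: scalar_prod_add_distrib[of _ n])
  next
    fix x assume "x \<in> int_lattice n"
    then show "vec target_dim (\<lambda>i. base_form (enum_ray i) \<bullet> x) \<in> int_lattice target_dim"
      using 1 by (auto simp: int_lattice_def[of target_dim] intro!: scalar_prod_Ints)
  qed auto
qed

section \<open>Images of the rays and the push-forward\<close>

lemma bergman_map_ray:
  assumes "v \<in> rays F" "i < target_dim"
  shows "bergman_map v $ i = of_bool (v = enum_ray i) - of_bool (v = base (enum_ray i))"
  using separates_base_form[OF enum_ray_unit[OF assms(2)]] assms
  by (simp add: bergman_map_def separates_def)

text \<open>Base rays are fixed by \<open>base\<close>, whereas the enumerated rays are exactly
  those unit rays that are not.\<close>

lemma base_enum_ray_neq:
  assumes "i < target_dim" "j < target_dim"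
  shows "base (enum_ray i) \<noteq> enum_ray j"
proof
  assume "base (enum_ray i) = enum_ray j"
  moreover from this have "base (enum_ray j) = enum_ray j"
    using base_base[OF enum_ray_unit[OF assms(1)]] by simp
  ultimately show False using enum_ray_free[OF assms(2)] by (simp add: free_rays_def)
qed

lemma bergman_map_ray_pm1:
  assumes "v \<in> rays F" "i < target_dim"
  shows "bergman_map v $ i = 1 \<longleftrightarrow> v = enum_ray i"
    and "bergman_map v $ i = -1 \<longleftrightarrow> v = base (enum_ray i)"
    and "bergman_map v $ i \<in> {-1, 0, 1}"
  using bergman_map_ray[OF assms] base_enum_ray_neq[OF assms(2) assms(2)] by auto

lemma bergman_map_int: "v \<in> rays F \<Longrightarrow> bergman_map v \<in> int_lattice target_dim"
  using bergman_map_int_linear ray_int unfolding int_linear_map_iff by blast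

lemma bergman_map_dim: "dim_vec (bergman_map v) = target_dim"
  by (simp add: bergman_map_def)

lemma bergman_map_nonzero_entry:
  assumes "v \<in> rays F" "bergman_map v \<noteq> 0\<^sub>v target_dim"
  obtains i where "i < target_dim" "v = enum_ray i \<or> v = base (enum_ray i)" "\<bar>bergman_map v $ i\<bar> = 1"
proof -
  obtain i where i: "i < target_dim" "bergman_map v $ i \<noteq> 0"
    using assms(2) by (metis bergman_map_dim eq_vecI index_zero_vec)
  then have "bergman_map v $ i = 1 \<or> bergman_map v $ i = -1"
    using bergman_map_ray_pm1(3)[OF assms(1) i(1)] by auto
  then show thesis using that[OF i(1)] bergman_map_ray_pm1(1,2)[OF assms(1) i(1)] by auto
qed

lemma bergman_map_primitive:
  assumes "v \<in> rays F"
  shows "bergman_map v = 0\<^sub>v target_dim \<or> primitive_vec target_dim (bergman_map v)"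
proof (cases "bergman_map v = 0\<^sub>v target_dim")
  case False
  then obtain i where "i < target_dim" "\<bar>bergman_map v $ i\<bar> = 1"
    using bergman_map_nonzero_entry[OF assms] by metis
  then show ?thesis using primitive_vec_unit_entry[OF bergman_map_int[OF assms]] by blast
qed simp

text \<open>An entry 1 in position \<open>i\<close> can only come from \<open>enum_ray i\<close>, an
  entry -1 only from its base ray; one nonzero entry thus recovers the ray.\<close>

lemma bergman_map_inj:
  assumes "v \<in> rays F" "w \<in> rays F" "bergman_map v \<noteq> 0\<^sub>v target_dim" "bergman_map v = bergman_map w"
  shows "v = w"
proof -
  obtain i where "i < target_dim" "v = enum_ray i \<or> v = base (enum_ray i)"
    using bergman_map_nonzero_entry[OF assms(1,3)] by metis
  then show ?thesis
    using bergman_map_ray_pm1(1,2)[OF assms(1)] bergman_map_ray_pm1(1,2)[OF assms(2)] assms(4) by metis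
qed

text \<open>The coordinates of one equivalence class, labelled by its base ray \<open>c\<close>,
  which has no coordinate itself.\<close>

definition block :: "real vec \<Rightarrow> nat set" where
  "block c = {i. i < target_dim \<and> base (enum_ray i) = c}"

lemma bergman_map_enum_ray:
  assumes "i < target_dim"
  shows "bergman_map (enum_ray i) = unit_vec target_dim i"
proof (rule eq_vecI)
  fix j assume "j < dim_vec (unit_vec target_dim i)"
  then have j: "j < target_dim" by simp
  have R: "enum_ray i \<in> rays F" using enum_ray_unit[OF assms] unit_rays_sub by blast
  show "bergman_map (enum_ray i) $ j = unit_vec target_dim i $ j"
    using bergman_map_ray[OF R j] enum_ray_inj[OF assms j] base_enum_ray_neq[OF j assms] j assms
    by (auto simp: unit_vec_def)
qed (simp add: bergman_map_dim)

text \<open>The base ray is subtracted in every coordinate of its class and in no other, so it takes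
  the part of the extra generator \<open>u 0\<close>.\<close>

lemma bergman_map_base:
  assumes "i < target_dim"
  shows "bergman_map (base (enum_ray i)) = - indicator_vec target_dim (block (base (enum_ray i)))"
proof (rule eq_vecI)
  fix j assume "j < dim_vec (- indicator_vec target_dim (block (base (enum_ray i))))"
  then have j: "j < target_dim" by (simp add: indicator_vec_def)
  have R: "base (enum_ray i) \<in> rays F"
    using base_unit_rays[OF enum_ray_unit[OF assms]] unit_rays_sub by blast
  show "bergman_map (base (enum_ray i)) $ j = (- indicator_vec target_dim (block (base (enum_ray i)))) $ j"
    using bergman_map_ray[OF R j] base_enum_ray_neq[OF assms j] j
    by (auto simp: indicator_vec_def block_def)
qed (simp add: bergman_map_dim indicator_vec_def)

lemma bergman_direct_sum_bergman_map:
  assumes "0 < target_dim"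
  shows "bergman_direct_sum target_dim (push_forward target_dim bergman_map F)"
proof (rule partition_bergman_direct_sum)
  let ?G = "push_forward target_dim bergman_map F"
  \<comment> \<open>Blocks are indexed by coordinates, so one-element classes, whose blocks would be
    empty, do not occur.\<close>
  let ?P = "(\<lambda>i. block (base (enum_ray i))) ` {..<target_dim}"
  show "?P \<noteq> {}" using assms by auto
  show "\<Union>?P = {..<target_dim}" by (auto simp: block_def)
  show "C \<noteq> {}" if "C \<in> ?P" for C using that by (auto simp: block_def)
  show "C = C'" if "C \<in> ?P" "C' \<in> ?P" "C \<inter> C' \<noteq> {}" for C C'
    using that by (auto simp: block_def)
  have pf: "rays ?G = {bergman_map v | v. v \<in> rays F \<and> bergman_map v \<noteq> 0\<^sub>v target_dim}"
    by (rule push_forward_primitive(1)) (rule bergman_map_primitive)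
  have unit: "v \<in> unit_rays" if "v \<in> rays F" "bergman_map v \<noteq> 0\<^sub>v target_dim" for v
    using bergman_map_nonzero_entry[OF that] enum_ray_unit base_unit_rays by metis
  show "weight ?G u = 1" if u: "u \<in> rays ?G" for u
  proof -
    obtain v where v: "v \<in> rays F" "u = bergman_map v" "bergman_map v \<noteq> 0\<^sub>v target_dim"
      using u unfolding pf by blast
    have "w = v" if "w \<in> rays F" "bergman_map w = u" for w
      using bergman_map_inj[OF v(1) that(1) v(3)] that(2) v(2) by simp
    \<comment> \<open>Injectivity away from zero makes the fibre a single ray, and rays with nonzero
      image have weight one.\<close>
    then have fib: "{w \<in> rays F. bergman_map w = u} = {v}" using v(1,2) by blast
    have "weight ?G u = (\<Sum>w\<in>{w\<in>rays F. bergman_map w = u}. weight F w)"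
      by (rule push_forward_primitive(2)[OF _ u]) (rule bergman_map_primitive)
    then show ?thesis using unit[OF v(1,3)] unfolding fib by (simp add: unit_rays_def)
  qed
  show "rays ?G = (\<Union>C\<in>?P. insert (- indicator_vec target_dim C) (unit_vec target_dim ` C))"
    (is "_ = ?U")
  proof (intro equalityI subsetI)
    fix u assume "u \<in> rays ?G"
    then obtain v where v: "v \<in> rays F" "u = bergman_map v" "bergman_map v \<noteq> 0\<^sub>v target_dim"
      unfolding pf by blast
    then obtain i where i: "i < target_dim" "v = enum_ray i \<or> v = base (enum_ray i)"
      using bergman_map_nonzero_entry by metis
    then have "u \<in> insert (- indicator_vec target_dim (block (base (enum_ray i))))
        (unit_vec target_dim ` block (base (enum_ray i)))"
      using v(2) bergman_map_enum_ray[OF i(1)] bergman_map_base[OF i(1)] by (auto simp: block_def)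
    then show "u \<in> ?U" using i(1) by blast
  next
    fix u assume "u \<in> ?U"
    then obtain i where i: "i < target_dim" and
      u: "u \<in> insert (- indicator_vec target_dim (block (base (enum_ray i))))
        (unit_vec target_dim ` block (base (enum_ray i)))" by blast
    from u show "u \<in> rays ?G"
    proof
      assume "u = - indicator_vec target_dim (block (base (enum_ray i)))"
      then have b: "u = bergman_map (base (enum_ray i))" using bergman_map_base[OF i] by simp
      have R: "base (enum_ray i) \<in> rays F"
        using base_unit_rays[OF enum_ray_unit[OF i]] unit_rays_sub by blast
      have "bergman_map (base (enum_ray i)) $ i = -1" using bergman_map_ray_pm1(2)[OF R i] by simp
      then have "bergman_map (base (enum_ray i)) \<noteq> 0\<^sub>v target_dim" using i by auto
      then show ?thesis unfolding pf using b R by blast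
    next
      assume "u \<in> unit_vec target_dim ` block (base (enum_ray i))"
      then obtain j where j: "j < target_dim" "u = unit_vec target_dim j" by (auto simp: block_def)
      have R: "enum_ray j \<in> rays F" using enum_ray_unit[OF j(1)] unit_rays_sub by blast
      have "bergman_map (enum_ray j) $ j = 1" using bergman_map_ray_pm1(1)[OF R j(1)] by simp
      then have "bergman_map (enum_ray j) \<noteq> 0\<^sub>v target_dim" using j(1) by auto
      then show ?thesis unfolding pf using bergman_map_enum_ray[OF j(1)] j(2) R by force
    qed
  qed
qed

section \<open>Regular forms as integral functions of the coordinates\<close>

lemma base_form_factors:
  assumes "v \<in> unit_rays"
  shows "\<exists>y\<in>int_lattice target_dim. \<forall>x\<in>carrier_vec n. base_form v \<bullet> x = y \<bullet> bergman_map x"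
proof (cases "base v = v")
  \<comment> \<open>A base ray has no coordinate, but its form is zero on all rays and hence
    everywhere.\<close>
  case True
  have "base_form v \<bullet> x = 0" if "x \<in> carrier_vec n" for x
    using fan_span_orthogonal[OF span fan_rays(3) base_form_carrier[OF assms] _ that]
      separates_base_form[OF assms] True by (simp add: separates_def)
  moreover have "0\<^sub>v target_dim \<bullet> bergman_map x = 0" for x
    by (rule scalar_prod_left_zero) (simp add: bergman_map_def)
  ultimately show ?thesis using int_lattice_closed(1) by metis
next
  case False
  then have "v \<in> free_rays" using assms by (simp add: free_rays_def)
  then have "v \<in> enum_ray ` {..<target_dim}" using enum_ray by (simp add: bij_betw_def)
  then obtain i where i: "i < target_dim" "enum_ray i = v" by auto
  have "base_form v \<bullet> x = unit_vec target_dim i \<bullet> bergman_map x" for x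
    using i by (simp add: bergman_map_def)
  then show ?thesis using unit_vec_int_lattice by blast
qed

text \<open>On the rays, \<open>a\<close> agrees with \<open>base_form v - base_form w\<close>: the
  linked rays \<open>v\<close> and \<open>w\<close> have the same base ray, whose contributions
  cancel. Spanning extends the equality to the whole space.\<close>

lemma regular_form_factors:
  assumes "regular_form a"
  shows "\<exists>y\<in>int_lattice target_dim. \<forall>x\<in>carrier_vec n. a \<bullet> x = y \<bullet> bergman_map x"
proof -
  obtain v w where vw: "linked v w" "separates a v w"
    using regular_form_separates[OF assms] by metis
  have U: "v \<in> unit_rays" "w \<in> unit_rays" using vw(1) by (auto simp: linked_def)
  obtain y z where yz: "y \<in> int_lattice target_dim" "\<forall>x\<in>carrier_vec n. base_form v \<bullet> x = y \<bullet> bergman_map x"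
      "z \<in> int_lattice target_dim" "\<forall>x\<in>carrier_vec n. base_form w \<bullet> x = z \<bullet> bergman_map x"
    using base_form_factors U by metis
  have c: "base_form v \<in> carrier_vec n" "base_form w \<in> carrier_vec n"
    using base_form_carrier U by auto
  have ac: "a \<in> carrier_vec n" using vw(2) int_lattice_carrier by (auto simp: separates_def)
  have "a \<bullet> x = (y - z) \<bullet> bergman_map x" if x: "x \<in> carrier_vec n" for x
  proof -
    have "a \<bullet> x = (base_form v - base_form w) \<bullet> x"
    proof (rule vec_eq_by_rays[OF span fan_rays(3) ac _ x])
      show "base_form v - base_form w \<in> carrier_vec n" using c by simp
      fix r assume r: "r \<in> rays F"
      show "a \<bullet> r = (base_form v - base_form w) \<bullet> r"
        using vw(2) separates_base_form[OF U(1)] separates_base_form[OF U(2)] base_eq[OF vw(1)] r c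
        by (simp add: separates_def minus_scalar_prod_distrib[OF c ray_carrier[OF r]])
    qed
    also have "\<dots> = y \<bullet> bergman_map x - z \<bullet> bergman_map x"
      using yz(2,4) x by (simp add: minus_scalar_prod_distrib[OF c x])
    also have "\<dots> = (y - z) \<bullet> bergman_map x"
      using yz(1,3) by (intro minus_scalar_prod_distrib[of _ target_dim, symmetric])
        (auto simp: bergman_map_def dest: int_lattice_carrier)
    finally show ?thesis .
  qed
  then show ?thesis using int_lattice_closed(4)[OF yz(1,3)] by blast
qed

text \<open>Two different rays with a common base ray cannot both be that base ray.\<close>

lemma regular_form_target_dim_pos:
  assumes "regular_form a"
  shows "0 < target_dim"
proof -
  obtain v w where vw: "v \<noteq> w" "linked v w"
    using regular_form_separates[OF assms] by metis
  have U: "v \<in> unit_rays" "w \<in> unit_rays" using vw(2) by (auto simp: linked_def)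
  have "base v = base w" by (rule base_eq[OF vw(2)])
  then have "v \<in> free_rays \<or> w \<in> free_rays" using U vw(1) by (auto simp: free_rays_def)
  then show ?thesis using enum_ray by (auto simp: bij_betw_def)
qed

section \<open>Universality\<close>

lemma regular_form_pull_back:
  assumes \<pi>: "int_linear_map n r \<pi>" and y: "y \<in> int_lattice r"
    and M: "intersection_number (\<lambda>v. max 0 (y \<bullet> v)) (push_forward r \<pi> F) = 1"
  shows "\<exists>a. regular_form a \<and> (\<forall>x\<in>carrier_vec n. a \<bullet> x = y \<bullet> \<pi> x)"
proof -
  have yc: "y \<in> carrier_vec r" by (rule int_lattice_carrier[OF y])
  have "int_linear_form n (\<lambda>x. y \<bullet> \<pi> x)"
    using \<pi> yc y unfolding int_linear_map_iff int_linear_form_def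
    by (auto simp: scalar_prod_add_distrib[of _ r] intro!: scalar_prod_Ints)
  then obtain a where a: "a \<in> int_lattice n" "\<forall>x\<in>carrier_vec n. y \<bullet> \<pi> x = a \<bullet> x"
    using int_linear_form_vec by blast
  \<comment> \<open>The positive part of a form is homogeneous under natural factors, so the
    projection formula applies.\<close>
  have "intersection_number (\<lambda>v. max 0 (y \<bullet> v)) (push_forward r \<pi> F)
      = intersection_number (\<lambda>v. max 0 (y \<bullet> \<pi> v)) F"
  proof (rule intersection_number_push_forward[OF fan_rays(1)])
    show "\<pi> v \<in> int_lattice r" if "v \<in> rays F" for v
      using \<pi> ray_int[OF that] by (simp add: int_linear_map_iff)
    show "max 0 (y \<bullet> (of_nat m \<cdot>\<^sub>v u)) = of_nat m * max 0 (y \<bullet> u)" if "u \<in> carrier_vec r" for m :: nat and u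
      using that yc by (simp add: max_def mult_le_0_iff zero_le_mult_iff)
  qed (use yc in simp)
  also have "\<dots> = intersection_number (\<lambda>v. max 0 (a \<bullet> v)) F"
    using a(2) ray_carrier unfolding intersection_number_def by (intro sum.cong) auto
  finally have "regular_form a" using M a(1) by (simp add: regular_form_def)
  then show ?thesis using a(2) by auto
qed

text \<open>In the dual expansion of the image of \<open>x\<close> the coefficients are pulled-back
  dual forms, hence regular, hence integral forms \<open>z q\<close> in the coordinates. Replacing
  the coordinates of \<open>x\<close> by a free variable \<open>t\<close> in this expansion defines
  \<open>\<psi>\<close>.\<close>

lemma bergman_map_universal:
  assumes \<pi>: "int_linear_map n r \<pi>" and B: "bergman_direct_sum r (push_forward r \<pi> F)"
  shows "\<exists>\<psi>. int_linear_map target_dim r \<psi> \<and> (\<forall>x\<in>carrier_vec n. \<pi> x = \<psi> (bergman_map x))"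
proof -
  obtain J :: "(nat \<times> nat) set" and u y where J: "finite J" "J \<noteq> {}"
    "\<forall>q\<in>J. u q \<in> rays (push_forward r \<pi> F)" "\<forall>q\<in>J. u q \<in> int_lattice r" "\<forall>q. y q \<in> int_lattice r"
    "\<forall>x\<in>carrier_vec r. vsum r (\<lambda>q. (y q \<bullet> x) \<cdot>\<^sub>v u q) J = x"
    "\<forall>q\<in>J. intersection_number (\<lambda>v. max 0 (y q \<bullet> v)) (push_forward r \<pi> F) = 1"
    using bergman_direct_sum_dual_basis[OF B] by (elim exE conjE) (rule that)
  note J = J(1,2) J(3-)[rule_format]
  have "\<forall>q\<in>J. \<exists>z. z \<in> int_lattice target_dim \<and> (\<forall>x\<in>carrier_vec n. y q \<bullet> \<pi> x = z \<bullet> bergman_map x)"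
  proof
    fix q assume q: "q \<in> J"
    obtain a where a: "regular_form a" "\<forall>x\<in>carrier_vec n. a \<bullet> x = y q \<bullet> \<pi> x"
      using regular_form_pull_back[OF \<pi> J(5) J(7)[OF q]] by blast
    then show "\<exists>z. z \<in> int_lattice target_dim \<and> (\<forall>x\<in>carrier_vec n. y q \<bullet> \<pi> x = z \<bullet> bergman_map x)"
      using regular_form_factors[OF a(1)] by auto
  qed
  from bchoice[OF this] obtain z where z: "\<And>q. q \<in> J \<Longrightarrow> z q \<in> int_lattice target_dim"
    "\<And>q x. q \<in> J \<Longrightarrow> x \<in> carrier_vec n \<Longrightarrow> y q \<bullet> \<pi> x = z q \<bullet> bergman_map x" by blast
  define \<psi> where "\<psi> t = vsum r (\<lambda>q. (z q \<bullet> t) \<cdot>\<^sub>v u q) J" for t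
  have uc: "u q \<in> carrier_vec r" if "q \<in> J" for q using J(4)[OF that] by (rule int_lattice_carrier)
  have zc: "z q \<in> carrier_vec target_dim" if "q \<in> J" for q using z(1)[OF that] by (rule int_lattice_carrier)
  have cl: "(\<lambda>q. (z q \<bullet> t) \<cdot>\<^sub>v u q) \<in> J \<rightarrow> carrier_vec r" for t using uc by auto
  have \<psi>c: "\<psi> t \<in> carrier_vec r" for t unfolding \<psi>_def by (rule vsum_closed[OF cl])
  have \<psi>i: "\<psi> t $ l = (\<Sum>q\<in>J. (z q \<bullet> t) * u q $ l)" if "l < r" for t l
    unfolding \<psi>_def index_finsum_vec[OF J(1) that cl]
    using that by (intro sum.cong) (auto simp: carrier_vecD[OF uc])
  have "int_linear_map target_dim r \<psi>"
    unfolding int_linear_map_iff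
  proof (intro conjI ballI allI \<psi>c)
    fix s t :: "real vec" and c :: real
    assume s: "s \<in> carrier_vec target_dim"
    show "\<psi> (c \<cdot>\<^sub>v s) = c \<cdot>\<^sub>v \<psi> s"
      using s zc carrier_vecD[OF \<psi>c]
      by (intro eq_vecI) (auto simp: \<psi>i sum_distrib_left mult.assoc intro!: sum.cong)
    assume t: "t \<in> carrier_vec target_dim"
    show "\<psi> (s + t) = \<psi> s + \<psi> t"
    proof (rule eq_vecI)
      fix l assume "l < dim_vec (\<psi> s + \<psi> t)"
      then have l: "l < r" by (simp add: carrier_vecD[OF \<psi>c])
      have "\<psi> (s + t) $ l = (\<Sum>q\<in>J. (z q \<bullet> s + z q \<bullet> t) * u q $ l)"
        unfolding \<psi>i[OF l] by (intro sum.cong refl) (simp add: scalar_prod_add_distrib[OF zc s t])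
      also have "\<dots> = (\<psi> s + \<psi> t) $ l"
        by (simp add: \<psi>i[OF l] l carrier_vecD[OF \<psi>c] distrib_right sum.distrib)
      finally show "\<psi> (s + t) $ l = (\<psi> s + \<psi> t) $ l" .
    qed (simp add: carrier_vecD[OF \<psi>c])
  next
    fix t assume t: "t \<in> int_lattice target_dim"
    show "\<psi> t \<in> int_lattice r"
      unfolding \<psi>_def using t z(1) J(4)
      by (intro vsum_int_lattice J(1)) (auto intro!: int_lattice_closed(5) scalar_prod_Ints)
  qed
  moreover have "\<pi> x = \<psi> (bergman_map x)" if x: "x \<in> carrier_vec n" for x
  proof -
    have "\<pi> x \<in> carrier_vec r" using \<pi> x by (simp add: int_linear_map_iff)
    then have "\<pi> x = vsum r (\<lambda>q. (y q \<bullet> \<pi> x) \<cdot>\<^sub>v u q) J" by (simp add: J(6))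
    also have "\<dots> = \<psi> (bergman_map x)"
      unfolding \<psi>_def using z(2)[OF _ x] uc J(1) by (intro vsum_cong) auto
    finally show ?thesis .
  qed
  ultimately show ?thesis by blast
qed

lemma universal_bergman_map_exists:
  assumes "regular_form a"
  shows "universal_bergman_map n F target_dim bergman_map"
  unfolding universal_bergman_map_def
  using bergman_map_int_linear bergman_map_universal
    bergman_direct_sum_bergman_map[OF regular_form_target_dim_pos[OF assms]] by blast

text \<open>A direct sum has at least one dual form, and any of them pulls back to a regular
  form.\<close>

lemma regular_form_of_bergman:
  assumes \<pi>: "int_linear_map n r \<pi>" and B: "bergman_direct_sum r (push_forward r \<pi> F)"
  shows "\<exists>a. regular_form a"
proof -
  obtain J :: "(nat \<times> nat) set" and u y where J: "finite J" "J \<noteq> {}"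
    "\<forall>q\<in>J. u q \<in> rays (push_forward r \<pi> F)" "\<forall>q\<in>J. u q \<in> int_lattice r" "\<forall>q. y q \<in> int_lattice r"
    "\<forall>x\<in>carrier_vec r. vsum r (\<lambda>q. (y q \<bullet> x) \<cdot>\<^sub>v u q) J = x"
    "\<forall>q\<in>J. intersection_number (\<lambda>v. max 0 (y q \<bullet> v)) (push_forward r \<pi> F) = 1"
    using bergman_direct_sum_dual_basis[OF B] by (elim exE conjE) (rule that)
  note J = J(1,2) J(3-)[rule_format]
  obtain q where q: "q \<in> J" using J(2) by blast
  obtain a where "regular_form a"
    using regular_form_pull_back[OF \<pi> J(5) J(7)[OF q]] by blast
  then show ?thesis by blast
qed

section \<open>Regular sequences as maxima of regular forms\<close>

lemma regular_form_regular_fan: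
  assumes "regular_form a"
  shows "regular_fan n F"
proof -
  have a: "a \<in> int_lattice n" "intersection_number (\<lambda>x. max 0 (a \<bullet> x)) F = 1"
    using assms by (simp_all add: regular_form_def)
  have "nonneg_TR n (\<lambda>x. max 0 (a \<bullet> x))"
    unfolding nonneg_TR_def
    using int_linear_form_scalar_prod[OF a(1)] by (intro exI[of _ "{\<lambda>x. a \<bullet> x}"]) simp
  then show ?thesis using a(2) unfolding regular_fan_def regular_sequence_def by blast
qed

text \<open>Intersection number zero makes the form at most 0 on every ray; its weighted sum is zero
  by balancing, so it vanishes on the rays and, by spanning, everywhere.\<close>

lemma zero_on_rays:
  assumes a: "a \<in> int_lattice n" and M: "intersection_number (\<lambda>x. max 0 (a \<bullet> x)) F = 0"
    and x: "x \<in> carrier_vec n"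
  shows "a \<bullet> x = 0"
proof (rule fan_span_orthogonal[OF span fan_rays(3) _ _ x])
  show ac: "a \<in> carrier_vec n" by (rule int_lattice_carrier[OF a])
  have "\<forall>v\<in>rays F. real (weight F v) * max 0 (a \<bullet> v) = 0"
    using M fan_rays(1) unfolding intersection_number_def by (simp add: sum_nonneg_eq_0_iff)
  then have le: "\<forall>v\<in>rays F. 0 \<le> - (real (weight F v) * (a \<bullet> v))"
    using fan_rays(4) by (fastforce simp: max_def mult_le_0_iff split: if_splits)
  have "(\<Sum>v\<in>rays F. - (real (weight F v) * (a \<bullet> v))) = 0"
    using tropical_fan_balance[OF trop ac] by (simp add: sum_negf)
  then have "\<forall>v\<in>rays F. - (real (weight F v) * (a \<bullet> v)) = 0"
    using le fan_rays(1) by (subst (asm) sum_nonneg_eq_0_iff) auto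
  then show "a \<bullet> v = 0" if "v \<in> rays F" for v using that fan_rays(4)[OF that] by auto
qed

text \<open>The positive part of each form is bounded by \<open>M\<close>, so its intersection
  number is an integer between 0 and 1. Value 1 is regularity; value 0 makes the form zero.\<close>

lemma regular_sequence_forms:
  assumes "regular_sequence n F M"
  shows "\<exists>A. finite A \<and> (\<forall>x\<in>carrier_vec n. M x = Max (insert 0 ((\<lambda>a. a \<bullet> x) ` A))) \<and>
    (\<forall>a\<in>A. regular_form a \<or> (\<forall>x\<in>carrier_vec n. a \<bullet> x = 0))"
proof -
  obtain L where L: "finite L" "\<forall>l\<in>L. int_linear_form n l"
    "\<forall>x\<in>carrier_vec n. M x = Max (insert 0 ((\<lambda>l. l x) ` L))"
    using assms unfolding regular_sequence_def nonneg_TR_def by blast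
  have M1: "intersection_number M F = 1" using assms by (simp add: regular_sequence_def)
  have "\<forall>l\<in>L. \<exists>a. a \<in> int_lattice n \<and> (\<forall>x\<in>carrier_vec n. l x = a \<bullet> x)"
    using L(2) int_linear_form_vec by blast
  from bchoice[OF this] obtain \<alpha> where \<alpha>: "\<And>l. l \<in> L \<Longrightarrow> \<alpha> l \<in> int_lattice n"
    "\<And>l x. l \<in> L \<Longrightarrow> x \<in> carrier_vec n \<Longrightarrow> l x = \<alpha> l \<bullet> x" by blast
  have Mx: "M x = Max (insert 0 ((\<lambda>a. a \<bullet> x) ` \<alpha> ` L))" if x: "x \<in> carrier_vec n" for x
  proof -
    have "(\<lambda>l. l x) ` L = (\<lambda>a. a \<bullet> x) ` \<alpha> ` L" using \<alpha>(2)[OF _ x] by (simp add: image_image)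
    then show ?thesis using L(3) x by simp
  qed
  show ?thesis
  proof (intro exI[of _ "\<alpha> ` L"] conjI ballI Mx)
    show "finite (\<alpha> ` L)" using L(1) by simp
    fix a assume a: "a \<in> \<alpha> ` L"
    then have aZ: "a \<in> int_lattice n" using \<alpha>(1) by blast
    let ?I = "intersection_number (\<lambda>x. max 0 (a \<bullet> x)) F"
    have "?I \<le> intersection_number M F"
      unfolding intersection_number_def
    proof (intro sum_mono mult_left_mono)
      fix v assume "v \<in> rays F"
      then have "M v = Max (insert 0 ((\<lambda>a. a \<bullet> v) ` \<alpha> ` L))" using Mx ray_carrier by blast
      then show "max 0 (a \<bullet> v) \<le> M v" using a L(1) by simp
    qed simp
    then have "?I \<le> 1" using M1 by simp
    moreover have "0 \<le> ?I" unfolding intersection_number_def by (intro sum_nonneg) simp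
    moreover have "?I \<in> \<int>"
      unfolding intersection_number_def
      using scalar_prod_Ints[OF aZ ray_int] by (intro Ints_sum Ints_mult) (auto simp: max_def)
    ultimately have "?I = 0 \<or> ?I = 1" by (auto elim!: Ints_cases)
    then show "regular_form a \<or> (\<forall>x\<in>carrier_vec n. a \<bullet> x = 0)"
    proof
      assume "?I = 0"
      then show ?thesis using zero_on_rays[OF aZ] by blast
    next
      assume "?I = 1"
      then show ?thesis using aZ unfolding regular_form_def by blast
    qed
  qed
qed

text \<open>Without a regular form all forms in the maximum would vanish, and \<open>M\<close> would
  be zero on the rays.\<close>

lemma regular_fan_regular_form:
  assumes "regular_fan n F"
  shows "\<exists>a. regular_form a"
proof (rule ccontr)
  assume no: "\<nexists>a. regular_form a"
  obtain M where M: "regular_sequence n F M" using assms by (auto simp: regular_fan_def)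
  obtain A where A: "\<forall>x\<in>carrier_vec n. M x = Max (insert 0 ((\<lambda>a. a \<bullet> x) ` A))"
    "\<forall>a\<in>A. regular_form a \<or> (\<forall>x\<in>carrier_vec n. a \<bullet> x = 0)"
    using regular_sequence_forms[OF M] by blast
  have "M v = 0" if v: "v \<in> rays F" for v
  proof -
    have "insert 0 ((\<lambda>a. a \<bullet> v) ` A) = {0}" using A(2) no ray_carrier[OF v] by auto
    then show ?thesis using A(1)[rule_format, OF ray_carrier[OF v]] by (simp only: Max_singleton)
  qed
  then have "intersection_number M F = 0" by (simp add: intersection_number_def)
  then show False using M by (simp add: regular_sequence_def)
qed

text \<open>Universality of the given map is applied to \<open>bergman_map\<close>, giving
  \<open>bergman_map\<close> as \<open>\<psi>\<close> after the given map. A form \<open>y\<close>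
  in the constructed coordinates thereby becomes the integral form \<open>y\<close> after
  \<open>\<psi>\<close> on the given target, and the maximum is lifted form by form.\<close>

lemma regular_sequence_lifts:
  assumes U: "universal_bergman_map n F d \<pi>" and M: "regular_sequence n F M"
  shows "\<exists>M'. regular_sequence d (push_forward d \<pi> F) M' \<and> (\<forall>x\<in>carrier_vec n. M x = M' (\<pi> x))"
proof -
  have \<pi>: "int_linear_map n d \<pi>" using U by (simp add: universal_bergman_map_def)
  obtain a where "regular_form a"
    using regular_fan_regular_form M by (auto simp: regular_fan_def)
  then have "universal_bergman_map n F target_dim bergman_map" by (rule universal_bergman_map_exists)
  then obtain \<psi> where \<psi>: "int_linear_map d target_dim \<psi>" "\<forall>x\<in>carrier_vec n. bergman_map x = \<psi> (\<pi> x)"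
    using U unfolding universal_bergman_map_def by blast
  obtain A where A: "finite A" "\<forall>x\<in>carrier_vec n. M x = Max (insert 0 ((\<lambda>a. a \<bullet> x) ` A))"
    "\<forall>a\<in>A. regular_form a \<or> (\<forall>x\<in>carrier_vec n. a \<bullet> x = 0)"
    using regular_sequence_forms[OF M] by blast
  have "\<forall>a\<in>A. \<exists>l. int_linear_form d l \<and> (\<forall>x\<in>carrier_vec n. a \<bullet> x = l (\<pi> x))"
  proof
    fix a assume "a \<in> A"
    then consider "regular_form a" | "\<forall>x\<in>carrier_vec n. a \<bullet> x = 0" using A(3) by blast
    then show "\<exists>l. int_linear_form d l \<and> (\<forall>x\<in>carrier_vec n. a \<bullet> x = l (\<pi> x))"
    proof cases
      case 1
      then obtain y where y: "y \<in> int_lattice target_dim" "\<forall>x\<in>carrier_vec n. a \<bullet> x = y \<bullet> bergman_map x"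
        using regular_form_factors by blast
      have "int_linear_form d (\<lambda>t. y \<bullet> \<psi> t)"
        using \<psi>(1) int_lattice_carrier[OF y(1)] y(1) unfolding int_linear_map_iff int_linear_form_def
        by (auto simp: scalar_prod_add_distrib[of _ target_dim] intro!: scalar_prod_Ints)
      then show ?thesis using y(2) \<psi>(2) by auto
    next
      case 2
      then show ?thesis by (intro exI[of _ "\<lambda>_. 0"]) (auto simp: int_linear_form_def)
    qed
  qed
  from bchoice[OF this] obtain l where l: "\<And>a. a \<in> A \<Longrightarrow> int_linear_form d (l a)"
    "\<And>a x. a \<in> A \<Longrightarrow> x \<in> carrier_vec n \<Longrightarrow> a \<bullet> x = l a (\<pi> x)" by blast
  define M' where "M' t = Max (insert 0 ((\<lambda>l. l t) ` l ` A))" for t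
  have lift: "M x = M' (\<pi> x)" if x: "x \<in> carrier_vec n" for x
  proof -
    have "(\<lambda>a. a \<bullet> x) ` A = (\<lambda>l. l (\<pi> x)) ` l ` A" using l(2)[OF _ x] by (simp add: image_image)
    then show ?thesis using A(2) x by (simp add: M'_def)
  qed
  have TR: "nonneg_TR d M'"
    unfolding nonneg_TR_def using A(1) l(1) by (intro exI[of _ "l ` A"]) (auto simp: M'_def)
  \<comment> \<open>Multiplication by a natural number is monotone and so commutes with the maximum.
    The projection formula then transfers the intersection number to the lift.\<close>
  have hom: "M' (of_nat m \<cdot>\<^sub>v u) = of_nat m * M' u" if u: "u \<in> carrier_vec d" for m :: nat and u
  proof -
    have "mono (\<lambda>t::real. of_nat m * t)" by (auto intro!: monoI mult_left_mono)
    then have "of_nat m * M' u = Max ((\<lambda>t. of_nat m * t) ` insert 0 ((\<lambda>l. l u) ` l ` A))"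
      unfolding M'_def using A(1) by (intro mono_Max_commute) auto
    also have "(\<lambda>t. of_nat m * t) ` insert 0 ((\<lambda>l. l u) ` l ` A) = insert 0 ((\<lambda>l. l (of_nat m \<cdot>\<^sub>v u)) ` l ` A)"
      using l(1) u by (auto simp: int_linear_form_def image_image)
    finally show ?thesis by (simp add: M'_def)
  qed
  have M0: "M' (0\<^sub>v d) = 0"
  proof -
    have "of_nat 0 \<cdot>\<^sub>v 0\<^sub>v d = (0\<^sub>v d :: real vec)" by auto
    then show ?thesis using hom[of "0\<^sub>v d" 0] by simp
  qed
  have "intersection_number M' (push_forward d \<pi> F) = intersection_number (\<lambda>v. M' (\<pi> v)) F"
    using \<pi> ray_int by (intro intersection_number_push_forward[OF fan_rays(1)] M0 hom) (auto simp: int_linear_map_iff)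
  also have "\<dots> = intersection_number M F"
    using lift ray_carrier unfolding intersection_number_def by (intro sum.cong) auto
  also have "\<dots> = 1" using M by (simp add: regular_sequence_def)
  finally show ?thesis using TR lift unfolding regular_sequence_def by blast
qed

end

theorem theorem1p1:
  fixes F :: fan and n :: nat
  assumes "tropical_fan n F"
    and "fan_span n F = carrier_vec n"
  shows "(regular_fan n F \<longleftrightarrow> (\<exists>d \<pi>F. universal_bergman_map n F d \<pi>F)) \<and>
    (regular_fan n F \<longrightarrow>
      (\<forall>d \<pi>F. universal_bergman_map n F d \<pi>F \<longrightarrow>
        d = fan_span_dim d (push_forward d \<pi>F F) \<and>
        (\<forall>M. regular_sequence n F M \<longrightarrow>
          (\<exists>M'. regular_sequence d (push_forward d \<pi>F F) M' \<and>
            (\<forall>x \<in> carrier_vec n. M x = M' (\<pi>F x))))))"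
proof -
  interpret spanning_fan n F using assms by unfold_locales
  \<comment> \<open>The cited facts close a circle: regular fan, regular form, universal map, and
    back through a dual form of the push-forward.\<close>
  have "regular_fan n F \<longleftrightarrow> (\<exists>d \<pi>F. universal_bergman_map n F d \<pi>F)"
    using regular_fan_regular_form universal_bergman_map_exists regular_form_of_bergman
      regular_form_regular_fan unfolding universal_bergman_map_def by metis
  moreover have "d = fan_span_dim d (push_forward d \<pi>F F)" if "universal_bergman_map n F d \<pi>F" for d \<pi>F
    using bergman_direct_sum_span_dim[OF _ push_forward_rays_carrier] that
    unfolding universal_bergman_map_def by simp
  ultimately show ?thesis using regular_sequence_lifts by blast
qed

end
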